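(* Let $L$ and $M$ be semistable Euclidean lattices. If $S$ is a nonzero sublattice of $L\otimes M$ with $\operatorname{rk}(S)\le 3$, then $\mu(S)\le \mu(L\otimes M)$.
   Context: A Euclidean lattice $L$ of rank $n$ is a discrete subgroup of rank $n$ spanning an $n$-dimensional real inner product space $L_{\mathbb{R}}$. Its degree is $\deg(L)=-\log \mathrm{vol}(L_{\mathbb{R}}/L)$ (volume of a fundamental parallelepiped), its rank is $\operatorname{rk}(L)=n$, and its slope is $\mu(L)=\deg(L)/\operatorname{rk}(L)$. A sublattice $S\subseteq L$ is a subgroup, regarded as a lattice in its real span with the induced inner product. $L$ is semistable if $\mu(S)\le\mu(L)$ for every nonzero sublattice $S\subseteq L$. For lattices $L,M$, the lattice $L\otimes M\subset L_{\mathbb{R}}\otimes M_{\mathbb{R}}$ (spanned by the $u\otimes u'$, $u\in L$, $u'\in M$) carries the inner product $(v\otimes w,v'\otimes w')=(v,v')(w,w')$. *)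

theory Defs
  imports "HOL-Analysis.Analysis"
begin

definition add_subgroup :: "('a::real_vector) set \<Rightarrow> bool" where
  "add_subgroup G \<longleftrightarrow> 0 \<in> G \<and> (\<forall>x\<in>G. \<forall>y\<in>G. x + y \<in> G) \<and> (\<forall>x\<in>G. - x \<in> G)"

text \<open>A Euclidean lattice: a discrete subgroup of a Euclidean space (a lattice in its real span).\<close>
definition is_lattice :: "('a::euclidean_space) set \<Rightarrow> bool" where
  "is_lattice L \<longleftrightarrow> add_subgroup L \<and> (\<exists>e>0. \<forall>x\<in>L. x \<noteq> 0 \<longrightarrow> e \<le> norm x)"

definition lat_rank :: "('a::euclidean_space) set \<Rightarrow> nat" where
  "lat_rank L = dim L"

definition lattice_basis :: "('a::euclidean_space) set \<Rightarrow> (nat \<Rightarrow> 'a) \<Rightarrow> nat \<Rightarrow> bool" where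
  "lattice_basis L b r \<longleftrightarrow> inj_on b {..<r} \<and> independent (b ` {..<r}) \<and>
     L = {x. \<exists>c::nat \<Rightarrow> int. x = (\<Sum>i<r. real_of_int (c i) *\<^sub>R b i)}"

definition gram_det :: "(nat \<Rightarrow> 'a::real_inner) \<Rightarrow> nat \<Rightarrow> real" where
  "gram_det b r = (\<Sum>p | p permutes {..<r}. of_int (sign p) * (\<Prod>i<r. inner (b i) (b (p i))))"

definition covol :: "('a::euclidean_space) set \<Rightarrow> real" where
  "covol L = sqrt (gram_det (SOME b. lattice_basis L b (lat_rank L)) (lat_rank L))"

definition lat_deg :: "('a::euclidean_space) set \<Rightarrow> real" where
  "lat_deg L = - ln (covol L)"

definition slope :: "('a::euclidean_space) set \<Rightarrow> real" where
  "slope L = lat_deg L / real (lat_rank L)"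

definition semistable :: "('a::euclidean_space) set \<Rightarrow> bool" where
  "semistable L \<longleftrightarrow> is_lattice L \<and>
     (\<forall>S. add_subgroup S \<and> S \<subseteq> L \<and> S \<noteq> {0} \<longrightarrow> slope S \<le> slope L)"

text \<open>Tensor u \<otimes> v in R^n \<otimes> R^m = R^(n x m) with the Frobenius inner product
  (inner product on real^'m^'n is componentwise), so (u\<otimes>v, u'\<otimes>v') = (u,u')(v,v').\<close>
definition outer :: "real^'n \<Rightarrow> real^'m \<Rightarrow> real^'m^'n" where
  "outer u v = (\<chi> i j. u $ i * v $ j)"

definition tensor_lat :: "(real^'n) set \<Rightarrow> (real^'m) set \<Rightarrow> (real^'m^'n) set" where
  "tensor_lat L M = \<Inter>{G. add_subgroup G \<and> {outer u v | u v. u \<in> L \<and> v \<in> M} \<subseteq> G}"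

end

theory Submission
  imports Defs "Jordan_Normal_Form.Determinant"
begin

text \<open>
  Put \<open>\<alpha> = exp (- 2 \<mu>(L))\<close>, \<open>\<beta> = exp (- 2 \<mu>(M))\<close> and \<open>t = \<alpha> \<beta>\<close>. Semistability says that \<open>r\<close> independent
  vectors of \<open>L\<close> have Gram determinant at least \<open>\<alpha> ^ r\<close>, and since \<open>\<mu>(L \<otimes> M) = \<mu>(L) + \<mu>(M)\<close> one has to
  show that a basis of \<open>S\<close>, of rank \<open>k\<close>, has Gram determinant at least \<open>t ^ k\<close>.

  A tensor \<open>\<Sum>i<r. u\<^sub>i \<otimes> v\<^sub>i\<close> written with the least number \<open>r\<close> of terms has independent \<open>u\<^sub>i\<close> and independent \<open>v\<^sub>i\<close>,
  so by Hadamard's inequality and AM-GM its squared norm is at least \<open>r t\<close>. Hence every nonzero tensor has squared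
  norm at least \<open>t\<close>, and at least \<open>2 t\<close> unless it is of the form \<open>u \<otimes> v\<close>. Since \<open>k \<le> 3\<close>, vectors attaining the
  successive minima form a basis of \<open>S\<close>. If the longest one has squared norm at least \<open>2 t\<close>, size reduction bounds
  the Gram determinant below by \<open>t ^ k\<close>. Otherwise all basis vectors are pure tensors \<open>u\<^sub>i \<otimes> v\<^sub>i\<close>. If the \<open>u\<^sub>i\<close> or the
  \<open>v\<^sub>i\<close> are independent, Oppenheim's inequality applies; if neither are, then \<open>k = 3\<close> and both triples span planes, and
  the determinant is estimated in terms of the \<open>2 \<times> 2\<close> minors of their coordinates.
\<close>

subsection \<open>Gram determinants and Gram--Schmidt orthogonalisation\<close>

text \<open>Makes multiplicativity, transposition and the rules for triangular determinants
  available for the Leibniz sum.\<close>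

lemma gram_det_eq_det:
  "gram_det b r = Determinant.det (Matrix.mat r r (\<lambda>(i, j). inner (b i) (b j)))"
proof -
  have "(\<Prod>i = 0..<r. Matrix.mat r r (\<lambda>(i, j). inner (b i) (b j)) $$ (i, p i))
      = (\<Prod>i<r. inner (b i) (b (p i)))" if "p permutes {..<r}" for p
    unfolding lessThan_atLeast0[symmetric] using permutes_in_image[OF that]
    by (intro prod.cong) auto
  then show ?thesis
    unfolding gram_det_def
    by (subst det_def'[of _ r]) (auto simp: lessThan_atLeast0[symmetric] intro!: sum.cong)
qed

text \<open>The Gram matrix \<open>G\<close> turns into \<open>T G T^t\<close>, and determinants are
  multiplicative.\<close>

lemma gram_det_transform:
  assumes T: "\<And>i. i < r \<Longrightarrow> b' i = (\<Sum>j<r. T i j *\<^sub>R b j)"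
  shows "gram_det b' r = (Determinant.det (Matrix.mat r r (\<lambda>(i, j). T i j)))\<^sup>2 * gram_det b r"
proof -
  let ?T = "Matrix.mat r r (\<lambda>(i, j). T i j)"
  let ?G = "\<lambda>b. Matrix.mat r r (\<lambda>(i, j). inner (b i) (b j))"
  have "?G b' = ?T * (?G b * transpose_mat ?T)"
  proof (rule eq_matI)
    fix i j assume "i < dim_row (?T * (?G b * transpose_mat ?T))" "j < dim_col (?T * (?G b * transpose_mat ?T))"
    then have ij: "i < r" "j < r" by auto
    have "inner (b' i) (b' j) = (\<Sum>k<r. T i k * (\<Sum>l<r. inner (b k) (b l) * T j l))"
      by (simp add: T ij inner_sum_left inner_sum_right sum_distrib_left mult_ac)
        (rule sum.swap)
    also have "\<dots> = (?T * (?G b * transpose_mat ?T)) $$ (i, j)"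
      using ij by (simp add: scalar_prod_def lessThan_atLeast0)
    finally show "?G b' $$ (i, j) = (?T * (?G b * transpose_mat ?T)) $$ (i, j)"
      using ij by simp
  qed auto
  moreover have "Determinant.det (?T * (?G b * transpose_mat ?T))
      = Determinant.det ?T * (Determinant.det (?G b) * Determinant.det ?T)"
    using det_mult[of ?T r "?G b * transpose_mat ?T"] det_mult[of "?G b" r "transpose_mat ?T"]
      det_transpose[of ?T r] mult_carrier_mat[of "?G b" r r "transpose_mat ?T" r] by simp
  ultimately show ?thesis
    unfolding gram_det_eq_det by (simp add: power2_eq_square)
qed

lemma det_unitriangular:
  fixes T :: "nat \<Rightarrow> nat \<Rightarrow> real"
  assumes "\<And>i. i < r \<Longrightarrow> T i i = 1"
    and "(\<forall>i<r. \<forall>j<r. i < j \<longrightarrow> T i j = 0) \<or> (\<forall>i<r. \<forall>j<r. j < i \<longrightarrow> T i j = 0)"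
  shows "Determinant.det (Matrix.mat r r (\<lambda>(i, j). T i j)) = 1"
proof -
  have "prod_list (diag_mat (Matrix.mat r r (\<lambda>(i, j). T i j))) = 1"
    using assms(1) by (subst prod_list_diag_prod) simp
  then show ?thesis
    using assms(2) det_lower_triangular[of r "Matrix.mat r r (\<lambda>(i, j). T i j)"]
      det_upper_triangular[of "Matrix.mat r r (\<lambda>(i, j). T i j)" r]
    by (auto simp: upper_triangular_def)
qed

text \<open>Both orientations occur: the Gram-Schmidt coefficients form a lower triangular matrix,
  and \<open>norm_sum_outer_ge\<close> uses its transpose.\<close>

lemma gram_det_unitriangular:
  assumes "\<And>i. i < r \<Longrightarrow> b' i = (\<Sum>j<r. T i j *\<^sub>R b j)"
    and "\<And>i. i < r \<Longrightarrow> T i i = 1"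
    and "(\<forall>i<r. \<forall>j<r. i < j \<longrightarrow> T i j = 0) \<or> (\<forall>i<r. \<forall>j<r. j < i \<longrightarrow> T i j = 0)"
  shows "gram_det b' r = gram_det b r"
  using gram_det_transform[of r b' T b, OF assms(1)] det_unitriangular[of r T, OF assms(2,3)] by simp

lemma gram_det_cong: "(\<And>i. i < r \<Longrightarrow> b i = c i) \<Longrightarrow> gram_det b r = gram_det c r"
  by (rule gram_det_unitriangular[where T = "\<lambda>i j. if i = j then 1 else 0"])
    (auto simp: if_distrib[of "\<lambda>x. x *\<^sub>R _"] sum.delta' cong: if_cong)

lemma gram_det_orthogonal:
  assumes "\<And>i j. i < r \<Longrightarrow> j < r \<Longrightarrow> i \<noteq> j \<Longrightarrow> inner (d i) (d j) = 0"
  shows "gram_det d r = (\<Prod>i<r. inner (d i) (d i))"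
proof -
  have "Determinant.det (Matrix.mat r r (\<lambda>(i, j). inner (d i) (d j)))
      = prod_list (diag_mat (Matrix.mat r r (\<lambda>(i, j). inner (d i) (d j))))"
    by (rule det_lower_triangular[of r]) (use assms in auto)
  then show ?thesis
    unfolding gram_det_eq_det prod_list_diag_prod by (simp add: lessThan_atLeast0)
qed

text \<open>Division by zero yields 0, so for a dependent family a vector in the span of its
  predecessors gets \<open>gso b i = 0\<close> and drops out of all later sums. The theory below
  thus covers dependent families as well.\<close>

fun gso :: "(nat \<Rightarrow> 'a::real_inner) \<Rightarrow> nat \<Rightarrow> 'a" where
  "gso b i = b i - (\<Sum>j<i. (inner (b i) (gso b j) / inner (gso b j) (gso b j)) *\<^sub>R gso b j)"

declare gso.simps [simp del]

text \<open>Padded with ones and zeros to a square unitriangular matrix, so that it can serve as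
  \<open>T\<close> in \<open>gram_det_unitriangular\<close>.\<close>

definition gso_coeff :: "(nat \<Rightarrow> 'a::real_inner) \<Rightarrow> nat \<Rightarrow> nat \<Rightarrow> real" where
  "gso_coeff b i j =
    (if j = i then 1 else if j < i then inner (b i) (gso b j) / inner (gso b j) (gso b j) else 0)"

lemma gso_orthogonal_less: "j < i \<Longrightarrow> inner (gso b i) (gso b j) = 0"
proof (induction i arbitrary: j rule: less_induct)
  case (less i)
  have orth: "inner (gso b k) (gso b j) = 0" if "k < i" "k \<noteq> j" for k
    using less.IH[of k j] less.IH[of j k] that less.prems by (cases k j rule: linorder_cases) (auto simp: inner_commute)
  have "inner (gso b i) (gso b j) = inner (b i) (gso b j)
     - (\<Sum>k<i. inner (b i) (gso b k) / inner (gso b k) (gso b k) * inner (gso b k) (gso b j))"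
    by (subst gso.simps) (simp add: inner_diff_left inner_sum_left)
  also have "(\<Sum>k<i. inner (b i) (gso b k) / inner (gso b k) (gso b k) * inner (gso b k) (gso b j))
     = (\<Sum>k<i. if k = j then inner (b i) (gso b j) else 0)"
    by (rule sum.cong) (auto simp: orth)
  finally show ?case using less.prems by simp
qed

lemma gso_orthogonal: "i \<noteq> j \<Longrightarrow> inner (gso b i) (gso b j) = 0"
  by (metis gso_orthogonal_less inner_commute linorder_neqE_nat)

lemma gso_expand:
  assumes "i < r"
  shows "b i = (\<Sum>j<r. gso_coeff b i j *\<^sub>R gso b j)"
proof -
  have "(\<Sum>j<r. gso_coeff b i j *\<^sub>R gso b j) = (\<Sum>j<Suc i. gso_coeff b i j *\<^sub>R gso b j)"
    by (rule sum.mono_neutral_right) (use assms in \<open>auto simp: gso_coeff_def\<close>)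
  also have "\<dots> = (\<Sum>j<i. (inner (b i) (gso b j) / inner (gso b j) (gso b j)) *\<^sub>R gso b j) + gso b i"
    by (simp add: gso_coeff_def)
  finally show ?thesis by (subst (asm) (2) gso.simps) simp
qed

text \<open>The passage from \<open>b\<close> to \<open>gso b\<close> is unitriangular, and the Gram
  matrix of \<open>gso b\<close> is diagonal.\<close>

lemma gram_det_eq_prod_gso: "gram_det b r = (\<Prod>i<r. inner (gso b i) (gso b i))"
proof -
  have "gram_det b r = gram_det (gso b) r"
    by (rule gram_det_unitriangular[where T = "gso_coeff b"], erule gso_expand)
      (auto simp: gso_coeff_def)
  then show ?thesis by (simp add: gram_det_orthogonal gso_orthogonal)
qed

lemma gram_det_nonneg: "0 \<le> gram_det b r"
  unfolding gram_det_eq_prod_gso by (intro prod_nonneg) auto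

lemma gram_det_Suc: "gram_det b (Suc r) = gram_det b r * inner (gso b r) (gso b r)"
  by (simp add: gram_det_eq_prod_gso)

lemma gram_det_0 [simp]: "gram_det b 0 = 1"
  by (simp add: gram_det_eq_prod_gso)

lemma gso_nonzero: "gram_det b r \<noteq> 0 \<Longrightarrow> i < r \<Longrightarrow> gso b i \<noteq> 0"
  by (auto simp: gram_det_eq_prod_gso)

lemma diff_gso_in_span: "b i - gso b i \<in> span (gso b ` {..<i})"
  unfolding gso.simps[of b i]
  by simp (intro span_sum span_scale span_base, simp)

lemma span_gso: "span (gso b ` {..<r}) = span (b ` {..<r})"
proof (induction r)
  case (Suc r)
  have d: "b r - gso b r \<in> span (gso b ` {..<r})" by (rule diff_gso_in_span)
  have "gso b r - b r \<in> span (gso b ` {..<r})" using span_neg[OF d] by simp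
  then have "span (insert (gso b r) (gso b ` {..<r})) = span (insert (b r) (gso b ` {..<r}))"
    by (rule eq_span_insert_eq)
  also have "\<dots> = span (insert (b r) (b ` {..<r}))"
    using Suc by (simp add: span_insert)
  finally show ?case by (simp add: lessThan_Suc)
qed simp

lemma inner_gso_span:
  assumes "x \<in> span (b ` {..<i})"
  shows "inner x (gso b i) = 0"
proof -
  have "x \<in> span (gso b ` {..<i})" using assms by (simp only: span_gso)
  then have "real_inner_class.orthogonal (gso b i) x"
    by (rule orthogonal_to_span) (auto simp: real_inner_class.orthogonal_def intro: gso_orthogonal)
  then show ?thesis by (simp add: real_inner_class.orthogonal_def inner_commute)
qed

lemma inner_gso_lower: "j < i \<Longrightarrow> inner (b j) (gso b i) = 0"
  by (rule inner_gso_span) (auto intro: span_base)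

lemma inner_gso_self: "inner (b i) (gso b i) = inner (gso b i) (gso b i)"
  using inner_gso_span[of "b i - gso b i" b i] diff_gso_in_span[of b i]
  by (simp add: span_gso inner_diff_left)

lemma gso_norm_le: "inner (gso b i) (gso b i) \<le> inner (b i) (b i)"
  using Cauchy_Schwarz_ineq[of "b i" "gso b i"] unfolding inner_gso_self power2_eq_square
  by (cases "gso b i = 0") auto

lemma gram_det_nonzero_component: "gram_det b r \<noteq> 0 \<Longrightarrow> i < r \<Longrightarrow> b i \<noteq> 0"
  using gso_nonzero[of b r i] inner_gso_self[of b i] by auto

lemma hadamard: "gram_det b r \<le> (\<Prod>i<r. inner (b i) (b i))"
  unfolding gram_det_eq_prod_gso by (rule prod_mono) (simp add: gso_norm_le)

text \<open>Pairing the relation with the last vector \<open>gso b r\<close>, which is orthogonal to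
  all earlier \<open>b i\<close>, isolates the last coefficient; the others follow by
  induction.\<close>

lemma gram_det_coeff_zero:
  assumes "gram_det b r \<noteq> 0" "(\<Sum>i<r. c i *\<^sub>R b i) = 0" "i < r"
  shows "c i = 0"
  using assms
proof (induction r)
  case (Suc r)
  have "(\<Sum>i<Suc r. c i * inner (b i) (gso b r)) = inner (\<Sum>i<Suc r. c i *\<^sub>R b i) (gso b r)"
    by (simp add: inner_sum_left inner_add_left)
  then have "c r * inner (gso b r) (gso b r) = 0"
    using Suc.prems by (simp add: inner_gso_lower inner_gso_self)
  then have "c r = 0" using gso_nonzero[OF Suc.prems(1), of r] by simp
  moreover have "gram_det b r \<noteq> 0" using Suc.prems(1) by (simp add: gram_det_Suc)
  ultimately show ?case using Suc by (cases "i = r") auto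
qed simp

lemma independent_iff_gram_det:
  fixes b :: "nat \<Rightarrow> 'a::euclidean_space"
  shows "inj_on b {..<r} \<and> independent (b ` {..<r}) \<longleftrightarrow> gram_det b r \<noteq> 0"
proof
  assume ind: "inj_on b {..<r} \<and> independent (b ` {..<r})"
  show "gram_det b r \<noteq> 0"
  proof
    assume "gram_det b r = 0"
    then obtain i where i: "i < r" "gso b i = 0" by (auto simp: gram_det_eq_prod_gso)
    then have "b i \<in> span (b ` {..<i})" using diff_gso_in_span[of b i] by (simp add: span_gso)
    moreover have "b ` {..<i} \<subseteq> b ` {..<r} - {b i}"
      using ind i by (auto simp: inj_on_def)
    ultimately have "b i \<in> span (b ` {..<r} - {b i})" using span_mono by blast
    then show False using ind i unfolding dependent_def by blast
  qed
next
  assume g: "gram_det b r \<noteq> 0"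
  have inj: "inj_on b {..<r}"
  proof (rule inj_onI, rule ccontr)
    fix i j assume ij: "i \<in> {..<r}" "j \<in> {..<r}" "b i = b j" "i \<noteq> j"
    \<comment> \<open>An equality \<open>b i = b j\<close> is a linear relation with coefficients 1
      at \<open>i\<close> and -1 at \<open>j\<close>.\<close>
    let ?c = "\<lambda>k. (if k = i then 1 else 0) - (if k = j then 1 else (0::real))"
    have "(\<Sum>k<r. ?c k *\<^sub>R b k) = 0"
      using ij by (simp add: scaleR_left_diff_distrib sum_subtractf if_distrib[of "\<lambda>x. x *\<^sub>R _"] cong: if_cong)
    from gram_det_coeff_zero[OF g this, of i] show False using ij by simp
  qed
  moreover have "independent (b ` {..<r})"
  proof (rule independent_if_scalars_zero)
    fix f x assume s: "(\<Sum>x\<in>b ` {..<r}. f x *\<^sub>R x) = 0" and x: "x \<in> b ` {..<r}"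
    have "(\<Sum>k<r. f (b k) *\<^sub>R b k) = 0"
      using s by (simp add: sum.reindex[OF inj] o_def)
    from gram_det_coeff_zero[OF g this] x show "f x = 0" by auto
  qed simp
  ultimately show "inj_on b {..<r} \<and> independent (b ` {..<r})" by blast
qed

subsection \<open>Bases of lattices\<close>

definition zspan :: "(nat \<Rightarrow> 'a::real_vector) \<Rightarrow> nat \<Rightarrow> 'a set" where
  "zspan b r = {x. \<exists>c::nat \<Rightarrow> int. x = (\<Sum>i<r. real_of_int (c i) *\<^sub>R b i)}"

lemma zspan_sum: "(\<Sum>i<r. real_of_int (c i) *\<^sub>R b i) \<in> zspan b r"
  unfolding zspan_def by auto

lemma lattice_basis_iff: "lattice_basis L b r \<longleftrightarrow> gram_det b r \<noteq> 0 \<and> L = zspan b r"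
  unfolding lattice_basis_def zspan_def independent_iff_gram_det[symmetric] by blast

lemma add_subgroup_diff: "add_subgroup G \<Longrightarrow> x \<in> G \<Longrightarrow> y \<in> G \<Longrightarrow> x - y \<in> G"
  unfolding add_subgroup_def by (metis diff_conv_add_uminus)

lemma add_subgroup_scale_nat: "add_subgroup G \<Longrightarrow> x \<in> G \<Longrightarrow> real k *\<^sub>R x \<in> G"
  by (induction k) (auto simp: add_subgroup_def scaleR_left_distrib)

lemma add_subgroup_scale_int: "add_subgroup G \<Longrightarrow> x \<in> G \<Longrightarrow> real_of_int k *\<^sub>R x \<in> G"
  using add_subgroup_scale_nat[of G x "nat k"] add_subgroup_scale_nat[of G x "nat (- k)"]
  by (cases "k \<ge> 0") (auto simp: add_subgroup_def)

lemma add_subgroup_sum: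
  "add_subgroup G \<Longrightarrow> (\<And>i. i \<in> A \<Longrightarrow> f i \<in> G) \<Longrightarrow> sum f A \<in> G"
  by (induction A rule: infinite_finite_induct) (auto simp: add_subgroup_def)

lemma zspan_least: "add_subgroup G \<Longrightarrow> (\<And>i. i < r \<Longrightarrow> b i \<in> G) \<Longrightarrow> zspan b r \<subseteq> G"
  unfolding zspan_def by (auto intro!: add_subgroup_sum add_subgroup_scale_int)

lemma add_subgroup_zspan: "add_subgroup (zspan b r)"
  unfolding add_subgroup_def
proof (intro conjI ballI)
  show "0 \<in> zspan b r" unfolding zspan_def by (auto intro!: exI[of _ "\<lambda>_. 0"])
next
  fix x y assume "x \<in> zspan b r" "y \<in> zspan b r"
  then obtain c d :: "nat \<Rightarrow> int" where
    "x = (\<Sum>i<r. real_of_int (c i) *\<^sub>R b i)" "y = (\<Sum>i<r. real_of_int (d i) *\<^sub>R b i)"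
    by (auto simp: zspan_def)
  then have "x + y = (\<Sum>i<r. real_of_int (c i + d i) *\<^sub>R b i)"
    by (simp add: scaleR_left_distrib sum.distrib)
  then show "x + y \<in> zspan b r" by (simp only: zspan_sum)
next
  fix x assume "x \<in> zspan b r"
  then obtain c :: "nat \<Rightarrow> int" where "x = (\<Sum>i<r. real_of_int (c i) *\<^sub>R b i)"
    by (auto simp: zspan_def)
  then have "- x = (\<Sum>i<r. real_of_int (- c i) *\<^sub>R b i)"
    by (simp add: sum_negf)
  then show "- x \<in> zspan b r" by (simp only: zspan_sum)
qed

lemma zspan_base: "i < r \<Longrightarrow> b i \<in> zspan b r"
  unfolding zspan_def
  by (auto intro!: exI[of _ "\<lambda>j. if j = i then 1 else 0"] simp: if_distrib[of real_of_int]
      if_distrib[of "\<lambda>x. x *\<^sub>R _"] cong: if_cong)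

lemma zspan_subset_span: "zspan b r \<subseteq> span (b ` {..<r})"
  unfolding zspan_def by (auto intro!: span_sum intro: span_scale span_base)

lemma span_zspan: "span (zspan b r) = span (b ` {..<r})"
proof
  show "span (zspan b r) \<subseteq> span (b ` {..<r})"
    using span_mono[OF zspan_subset_span] by (simp add: span_span)
  show "span (b ` {..<r}) \<subseteq> span (zspan b r)"
    by (rule span_mono) (auto intro: zspan_base)
qed

lemma dim_eq_of_lattice_basis:
  assumes "lattice_basis L b r"
  shows "dim L = r"
proof -
  have i: "inj_on b {..<r}" "independent (b ` {..<r})" and L: "L = zspan b r"
    using assms by (auto simp: lattice_basis_iff independent_iff_gram_det[symmetric])
  have "dim L = dim (b ` {..<r})"
    unfolding L by (metis dim_span span_zspan)
  also have "\<dots> = r" using i by (simp add: dim_eq_card_independent card_image)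
  finally show ?thesis .
qed

text \<open>Each of the two Gram determinants is the other one times the square of a nonzero integer.\<close>
lemma gram_det_basis_unique:
  assumes b: "lattice_basis L b r" and c: "lattice_basis L c r"
  shows "gram_det b r = gram_det c r"
proof -
  have ex: "\<exists>m::int. gram_det b r = (of_int m)\<^sup>2 * gram_det c r"
    if b: "lattice_basis L b r" and c: "lattice_basis L c r" for b c
  proof -
    have "\<forall>i. \<exists>t::nat \<Rightarrow> int. i < r \<longrightarrow> b i = (\<Sum>j<r. of_int (t j) *\<^sub>R c j)"
      using b c zspan_base[of _ r b] by (auto simp: lattice_basis_iff zspan_def)
    then obtain T :: "nat \<Rightarrow> nat \<Rightarrow> int" where
      T: "\<And>i. i < r \<Longrightarrow> b i = (\<Sum>j<r. of_int (T i j) *\<^sub>R c j)" by metis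
    have "Determinant.det (Matrix.mat r r (\<lambda>(i, j). real_of_int (T i j)))
        = of_int (Determinant.det (Matrix.mat r r (\<lambda>(i, j). T i j)))"
      unfolding of_int_hom.hom_det[symmetric]
      by (rule arg_cong[of _ _ Determinant.det], rule eq_matI) auto
    then show ?thesis using gram_det_transform[of r b "\<lambda>i j. of_int (T i j)" c, OF T] by auto
  qed
  have le: "gram_det b r \<ge> gram_det c r"
    if b: "lattice_basis L b r" and c: "lattice_basis L c r" for b c
  proof -
    obtain m :: int where m: "gram_det b r = (of_int m)\<^sup>2 * gram_det c r" using ex[OF b c] by blast
    then have "m \<noteq> 0" using b by (auto simp: lattice_basis_iff)
    then have "1 \<le> m\<^sup>2" by (simp add: int_one_le_iff_zero_less)
    then have "(1::real) \<le> (of_int m)\<^sup>2" by (metis of_int_1 of_int_le_iff of_int_power)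
    then show ?thesis using m mult_right_mono[OF _ gram_det_nonneg[of c r]] by fastforce
  qed
  show ?thesis using le[OF b c] le[OF c b] by simp
qed

lemma covol_eq:
  assumes "lattice_basis L b r"
  shows "covol L = sqrt (gram_det b r)"
proof -
  have r: "lat_rank L = r" using dim_eq_of_lattice_basis[OF assms] by (simp add: lat_rank_def)
  have "lattice_basis L (SOME b. lattice_basis L b r) r"
    by (rule someI[of "\<lambda>b. lattice_basis L b r", OF assms])
  then show ?thesis
    unfolding covol_def r using gram_det_basis_unique[OF _ assms] by simp
qed

lemma gram_det_basis_pos: "lattice_basis L b r \<Longrightarrow> gram_det b r > 0"
  using gram_det_nonneg[of b r] by (auto simp: lattice_basis_iff less_le)

lemma slope_eq:
  assumes "lattice_basis L b r"
  shows "slope L = - ln (gram_det b r) / (2 * real r)"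
  using covol_eq[OF assms] dim_eq_of_lattice_basis[OF assms] gram_det_basis_pos[OF assms]
  by (simp add: slope_def lat_deg_def lat_rank_def ln_sqrt)

text \<open>The only form in which semistability is used: it is applied to the sublattice
  \<open>zspan u r\<close>, whose slope is \<open>- ln (gram_det u r) / (2 * r)\<close>.\<close>

lemma semistable_gram_det_ge:
  assumes L: "semistable L" and u: "\<And>i. i < r \<Longrightarrow> u i \<in> L" and g: "gram_det u r \<noteq> 0"
  shows "exp (- 2 * slope L) ^ r \<le> gram_det u r"
proof (cases "r = 0")
  case False
  let ?S = "zspan u r"
  have sub: "?S \<subseteq> L" using L u by (intro zspan_least) (auto simp: semistable_def is_lattice_def)
  have basis: "lattice_basis ?S u r" using g by (simp add: lattice_basis_iff)
  have "u 0 \<in> ?S" using False by (intro zspan_base) simp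
  moreover have "u 0 \<noteq> 0" using False gso_nonzero[OF g, of 0] by (simp add: gso.simps[of u 0])
  ultimately have "?S \<noteq> {0}" by blast
  then have "slope ?S \<le> slope L"
    using L sub add_subgroup_zspan[of u r] by (simp add: semistable_def)
  then have "slope ?S * (2 * real r) \<le> slope L * (2 * real r)"
    by (rule mult_right_mono) simp
  moreover have "slope ?S * (2 * real r) = - ln (gram_det u r)"
    using False by (simp add: slope_eq[OF basis])
  ultimately have "- 2 * slope L * real r \<le> ln (gram_det u r)" by simp
  then have "exp (- 2 * slope L * real r) \<le> gram_det u r"
    using gram_det_basis_pos[OF basis] ln_ge_iff[of "gram_det u r"] by blast
  then show ?thesis by (simp only: exp_of_nat2_mult)
qed simp

subsection \<open>Existence of bases\<close>

lemma is_lattice_subgroup: "is_lattice L \<Longrightarrow> add_subgroup S \<Longrightarrow> S \<subseteq> L \<Longrightarrow> is_lattice S"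
  unfolding is_lattice_def by blast

text \<open>Differences of lattice points are lattice points, so a ball contains a bounded,
  uniformly discrete set of them. This provides the minimal vectors chosen below.\<close>

lemma finite_lattice_cball:
  assumes "is_lattice L"
  shows "finite {x \<in> L. norm x \<le> R}"
proof -
  obtain e where e: "e > 0" "\<And>x. x \<in> L \<Longrightarrow> x \<noteq> 0 \<Longrightarrow> e \<le> norm x"
    using assms by (auto simp: is_lattice_def)
  have "dist x y < e \<longrightarrow> x = y" if "x \<in> L" "y \<in> L" for x y
    using e(2)[of "x - y"] add_subgroup_diff[of L x y] assms that
    by (force simp: is_lattice_def dist_norm)
  then have "uniform_discrete {x \<in> L. norm x \<le> R}"
    unfolding uniform_discrete_def using e(1) by blast
  moreover have "bounded {x \<in> L. norm x \<le> R}" by (auto simp: bounded_iff)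
  ultimately show ?thesis using uniform_discrete_finite_iff by blast
qed

lemma gso_cong: "(\<And>j. j \<le> i \<Longrightarrow> b j = c j) \<Longrightarrow> gso b i = gso c i"
proof (induction i rule: less_induct)
  case (less i)
  have "gso b j = gso c j" if "j < i" for j using less.IH[OF that] less.prems that by auto
  then show ?case unfolding gso.simps[of _ i] using less.prems[of i] by simp
qed

section \<open>Size reduction along the Gram-Schmidt vectors\<close>

lemma span_gso_expand:
  assumes "y \<in> span (b ` {..<r})"
  shows "y = (\<Sum>i<r. (inner y (gso b i) / inner (gso b i) (gso b i)) *\<^sub>R gso b i)"
proof -
  define z where "z = y - (\<Sum>i<r. (inner y (gso b i) / inner (gso b i) (gso b i)) *\<^sub>R gso b i)"
  have y: "y \<in> span (gso b ` {..<r})" using assms by (simp only: span_gso)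
  moreover have "(\<Sum>i<r. (inner y (gso b i) / inner (gso b i) (gso b i)) *\<^sub>R gso b i) \<in> span (gso b ` {..<r})"
    by (intro span_sum span_scale span_base) auto
  ultimately have z: "z \<in> span (gso b ` {..<r})"
    unfolding z_def by (rule span_diff)
  have "inner z (gso b j) = 0" if "j < r" for j
  proof -
    have "(\<Sum>i<r. inner y (gso b i) / inner (gso b i) (gso b i) * inner (gso b i) (gso b j))
       = (\<Sum>i<r. if i = j then inner y (gso b j) else 0)"
      by (rule sum.cong) (auto simp: gso_orthogonal)
    then show ?thesis using that by (simp add: z_def inner_diff_left inner_sum_left)
  qed
  then have "real_inner_class.orthogonal z z"
    by (intro orthogonal_to_span[OF z]) (auto simp: real_inner_class.orthogonal_def)
  then show ?thesis by (simp add: real_inner_class.orthogonal_def z_def)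
qed

lemma span_gso_parseval:
  assumes "y \<in> span (b ` {..<r})"
  shows "inner y y = (\<Sum>i<r. (inner y (gso b i))\<^sup>2 / inner (gso b i) (gso b i))"
  by (subst span_gso_expand[OF assms], subst inner_sum_left)
    (simp add: power2_eq_square inner_commute)

text \<open>Babai's nearest plane algorithm: round the coefficients from the top down.\<close>
lemma nearest_plane:
  "\<exists>c::nat \<Rightarrow> int. \<forall>i<r. \<bar>inner (y - (\<Sum>j<r. of_int (c j) *\<^sub>R b j)) (gso b i)\<bar>
      \<le> inner (gso b i) (gso b i) / 2"
proof (induction r arbitrary: y)
  case (Suc r)
  let ?d = "gso b r"
  define k where "k = round (inner y ?d / inner ?d ?d)"
  obtain c :: "nat \<Rightarrow> int" where
    c: "\<And>i. i < r \<Longrightarrow> \<bar>inner (y - of_int k *\<^sub>R b r - (\<Sum>j<r. of_int (c j) *\<^sub>R b j)) (gso b i)\<bar>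
      \<le> inner (gso b i) (gso b i) / 2"
    using Suc[of "y - of_int k *\<^sub>R b r"] by blast
  have eq: "y - (\<Sum>j<Suc r. of_int ((c(r := k)) j) *\<^sub>R b j)
     = y - of_int k *\<^sub>R b r - (\<Sum>j<r. of_int (c j) *\<^sub>R b j)" by simp
  have "inner (y - of_int k *\<^sub>R b r - (\<Sum>j<r. of_int (c j) *\<^sub>R b j)) ?d = inner y ?d - of_int k * inner ?d ?d"
    by (simp add: inner_diff_left inner_sum_left inner_gso_lower inner_gso_self)
  moreover have "\<bar>inner y ?d - of_int k * inner ?d ?d\<bar> \<le> inner ?d ?d / 2"
  proof (cases "?d = 0")
    case False
    then have p: "inner ?d ?d > 0" by simp
    have "inner y ?d - of_int k * inner ?d ?d = - (of_int k - inner y ?d / inner ?d ?d) * inner ?d ?d"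
      using False by (simp add: field_simps)
    then have "\<bar>inner y ?d - of_int k * inner ?d ?d\<bar> = \<bar>of_int k - inner y ?d / inner ?d ?d\<bar> * inner ?d ?d"
      using p by (simp add: abs_mult)
    also have "\<dots> \<le> 1 / 2 * inner ?d ?d"
      unfolding k_def using of_int_round_abs_le[of "inner y ?d / inner ?d ?d"] p
      by (intro mult_right_mono) auto
    finally show ?thesis by simp
  qed simp
  ultimately have "\<bar>inner (y - (\<Sum>j<Suc r. of_int ((c(r := k)) j) *\<^sub>R b j)) (gso b i)\<bar>
      \<le> inner (gso b i) (gso b i) / 2" if "i < Suc r" for i
    unfolding eq using c[of i] that by (cases "i = r") simp_all
  then show ?case by blast
qed simp

text \<open>Write D for the squared norm of a Gram-Schmidt vector. By Parseval its direction
  contributes at most (D/2)^2 / D = D/4.\<close>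

lemma reduced_norm_le:
  assumes y: "y \<in> span (b ` {..<r})"
    and red: "\<And>i. i < r \<Longrightarrow> \<bar>inner y (gso b i)\<bar> \<le> inner (gso b i) (gso b i) / 2"
  shows "inner y y \<le> (\<Sum>i<r. inner (gso b i) (gso b i)) / 4"
proof -
  have "(inner y (gso b i))\<^sup>2 / inner (gso b i) (gso b i) \<le> inner (gso b i) (gso b i) / 4" if "i < r" for i
  proof (cases "gso b i = 0")
    case False
    have "(inner y (gso b i))\<^sup>2 \<le> (inner (gso b i) (gso b i) / 2)\<^sup>2"
      using red[OF that] abs_le_square_iff[of "inner y (gso b i)" "inner (gso b i) (gso b i) / 2"] by simp
    then show ?thesis using False by (simp add: field_simps power2_eq_square)
  qed simp
  then have "inner y y \<le> (\<Sum>i<r. inner (gso b i) (gso b i) / 4)"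
    unfolding span_gso_parseval[OF y] by (intro sum_mono) auto
  then show ?thesis by (simp add: sum_divide_distrib)
qed

text \<open>The last clause says that \<open>b\<close> generates a saturated sublattice, so
  \<open>b\<close> can be extended one vector at a time; at length \<open>dim L\<close> it is a
  basis.\<close>

definition primitive_system :: "'a::euclidean_space set \<Rightarrow> (nat \<Rightarrow> 'a) \<Rightarrow> nat \<Rightarrow> bool" where
  "primitive_system L b k \<longleftrightarrow>
     gram_det b k \<noteq> 0 \<and> (\<forall>i<k. b i \<in> L) \<and> L \<inter> span (b ` {..<k}) = zspan b k"

lemma zspan_cong: "(\<And>i. i < r \<Longrightarrow> b i = c i) \<Longrightarrow> zspan b r = zspan c r"
  unfolding zspan_def by simp

lemma primitive_system_cong:
  assumes "\<And>i. i < k \<Longrightarrow> b i = c i"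
  shows "primitive_system L b k \<longleftrightarrow> primitive_system L c k"
proof -
  have "b ` {..<k} = c ` {..<k}" using assms by auto
  then show ?thesis
    unfolding primitive_system_def using gram_det_cong[of k b c] zspan_cong[of k b c] assms by auto
qed

text \<open>Rounding reduces any lattice vector of the new span modulo
  \<open>zspan b (Suc k)\<close> to a small remainder. Assumption \<open>red\<close> puts that
  remainder into the old span, where primitivity applies. The two constructions of bases below
  differ only in how they verify \<open>red\<close>.\<close>

lemma primitive_system_Suc:
  assumes L: "add_subgroup L" and prim: "primitive_system L b k"
    and bk: "b k \<in> L" "b k \<notin> span (b ` {..<k})"
    and red: "\<And>z. z \<in> L \<Longrightarrow> z \<in> span (b ` {..<Suc k}) \<Longrightarrow>
      (\<And>i. i < Suc k \<Longrightarrow> \<bar>inner z (gso b i)\<bar> \<le> inner (gso b i) (gso b i) / 2) \<Longrightarrow> z \<in> span (b ` {..<k})"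
  shows "primitive_system L b (Suc k)"
proof -
  have "gso b k \<noteq> 0" using bk(2) diff_gso_in_span[of b k] by (auto simp: span_gso)
  then have "gram_det b (Suc k) \<noteq> 0" using prim by (simp add: gram_det_Suc primitive_system_def)
  moreover have bL: "b i \<in> L" if "i < Suc k" for i
    using prim bk that by (auto simp: primitive_system_def less_Suc_eq)
  moreover have zL: "zspan b (Suc k) \<subseteq> L" by (rule zspan_least[OF L]) (rule bL)
  have "L \<inter> span (b ` {..<Suc k}) = zspan b (Suc k)"
  proof
    show "zspan b (Suc k) \<subseteq> L \<inter> span (b ` {..<Suc k})"
      using zL zspan_subset_span[of b "Suc k"] by blast
    show "L \<inter> span (b ` {..<Suc k}) \<subseteq> zspan b (Suc k)"
    proof
      fix y assume y: "y \<in> L \<inter> span (b ` {..<Suc k})"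
      obtain c :: "nat \<Rightarrow> int" where c: "\<And>i. i < Suc k \<Longrightarrow>
          \<bar>inner (y - (\<Sum>j<Suc k. of_int (c j) *\<^sub>R b j)) (gso b i)\<bar> \<le> inner (gso b i) (gso b i) / 2"
        using nearest_plane[of "Suc k" y b] by blast
      define w where "w = (\<Sum>j<Suc k. of_int (c j) *\<^sub>R b j)"
      have w: "w \<in> zspan b (Suc k)" unfolding w_def by (rule zspan_sum)
      then have wL: "w \<in> L" "w \<in> span (b ` {..<Suc k})"
        using zL zspan_subset_span[of b "Suc k"] by blast+
      have "y - w \<in> span (b ` {..<k})"
      proof (rule red)
        show "y - w \<in> L" using y wL L by (auto intro: add_subgroup_diff)
        show "y - w \<in> span (b ` {..<Suc k})" using y wL(2) by (intro span_diff) simp_all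
      qed (unfold w_def, rule c)
      then have "y - w \<in> zspan b k"
        using prim y wL add_subgroup_diff[OF L] by (auto simp: primitive_system_def)
      moreover have "zspan b k \<subseteq> zspan b (Suc k)"
        by (rule zspan_least[OF add_subgroup_zspan]) (auto intro: zspan_base)
      ultimately have "y - w + w \<in> zspan b (Suc k)"
        using w add_subgroup_zspan[of b "Suc k"] unfolding add_subgroup_def by blast
      then show "y \<in> zspan b (Suc k)" by simp
    qed
  qed
  ultimately show ?thesis using bL unfolding primitive_system_def by blast
qed

text \<open>Extend by a vector whose distance to the span of the previous ones is minimal.\<close>
lemma primitive_system_extend:
  assumes L: "is_lattice L" and prim: "primitive_system L b k"
    and x: "x \<in> L" "x \<notin> span (b ` {..<k})"
  shows "\<exists>y. primitive_system L (b(k := y)) (Suc k)"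
proof -
  have [simp]: "b(k := y) ` {..<k} = b ` {..<k}" for y by auto
  have g: "gso (b(k := y)) i = gso b i" if "i < k" for i y using that by (intro gso_cong) auto
  \<comment> \<open>The radius is large enough for \<open>F\<close> to contain both \<open>x\<close>
    and every size-reduced vector \<open>z\<close> outside the old span, yet keeps \<open>F\<close>
    finite.\<close>
  define R where "R = (\<Sum>i<k. inner (gso b i) (gso b i)) + inner x x"
  define F where "F = {y \<in> L. y \<notin> span (b ` {..<k}) \<and> inner y y \<le> R}"
  define f where "f y = inner (gso (b(k := y)) k) (gso (b(k := y)) k)" for y
  have "F \<subseteq> {y \<in> L. norm y \<le> sqrt R}"
    by (auto simp: F_def norm_eq_sqrt_inner)
  then have "finite F" using finite_lattice_cball[OF L] finite_subset by blast
  moreover have "x \<in> F" unfolding F_def R_def using x by (auto intro: sum_nonneg)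
  ultimately obtain y where y: "y \<in> F" "\<And>z. z \<in> F \<Longrightarrow> f y \<le> f z"
    using arg_min_if_finite[of F f] by (metis empty_iff not_le_imp_less)
  let ?b = "b(k := y)"
  have "primitive_system L ?b (Suc k)"
  proof (rule primitive_system_Suc)
    show "add_subgroup L" using L by (simp add: is_lattice_def)
    show "primitive_system L ?b k" using prim primitive_system_cong[of k b ?b L] by auto
    show "?b k \<in> L" "?b k \<notin> span (?b ` {..<k})" using y by (auto simp: F_def)
    then have d0: "gso ?b k \<noteq> 0" using diff_gso_in_span[of ?b k] by (auto simp: span_gso)
    fix z assume z: "z \<in> L" "z \<in> span (?b ` {..<Suc k})"
      "\<And>i. i < Suc k \<Longrightarrow> \<bar>inner z (gso ?b i)\<bar> \<le> inner (gso ?b i) (gso ?b i) / 2"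
    show "z \<in> span (?b ` {..<k})"
    proof (rule ccontr)
      assume nz: "z \<notin> span (?b ` {..<k})"
      have fx: "f y \<le> inner x x"
        using y(2)[OF \<open>x \<in> F\<close>] gso_norm_le[of "b(k := x)" k] by (simp add: f_def)
      have "inner z z \<le> (\<Sum>i<Suc k. inner (gso ?b i) (gso ?b i)) / 4"
        by (rule reduced_norm_le[OF z(2,3)])
      also have "\<dots> = ((\<Sum>i<k. inner (gso b i) (gso b i)) + f y) / 4" by (simp add: g f_def)
      also have "\<dots> \<le> R / 4" using fx by (simp add: R_def)
      also have "\<dots> \<le> R" by (simp add: R_def sum_nonneg add_nonneg_nonneg)
      finally have "z \<in> F" using z nz by (simp add: F_def)
      \<comment> \<open>The distance of \<open>z\<close> from the old span is that of
        \<open>y\<close> scaled by \<open>c\<close>. Reduction gives \<open>c\<close> absolute value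
        at most 1/2, so \<open>z\<close> would be strictly closer than the closest vector
        \<open>y\<close>.\<close>
      define c where "c = inner z (gso ?b k) / inner (gso ?b k) (gso ?b k)"
      have "gso (b(k := z)) k = z - (\<Sum>i<k. (inner z (gso b i) / inner (gso b i) (gso b i)) *\<^sub>R gso b i)"
        by (subst gso.simps) (simp add: g)
      also have "\<dots> = c *\<^sub>R gso ?b k"
        using span_gso_expand[OF z(2)] by (simp add: g c_def algebra_simps)
      finally have fz: "f z = c\<^sup>2 * f y" by (simp add: f_def power2_eq_square)
      have "f y > 0" using d0 by (simp add: f_def)
      have "\<bar>c\<bar> \<le> 1/2" unfolding c_def using z(3)[of k] d0 by (simp add: field_simps)
      then have "c\<^sup>2 \<le> (1/2)\<^sup>2" using abs_le_square_iff[of c "1/2"] by simp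
      then have "c\<^sup>2 < 1" by (simp add: power2_eq_square)
      then have "f z < f y"
        using mult_strict_right_mono[of "c\<^sup>2" 1 "f y"] \<open>f y > 0\<close> fz by simp
      then show False using y(2)[OF \<open>z \<in> F\<close>] by simp
    qed
  qed
  then show ?thesis by blast
qed

lemma exists_outside_span:
  assumes "finite A" "card A < dim (L :: 'a::euclidean_space set)"
  shows "\<exists>x\<in>L. x \<notin> span A"
  using assms dim_le_card[of L A] by fastforce

lemma lattice_basis_of_primitive_system:
  assumes "primitive_system L b (dim L)"
  shows "lattice_basis L b (dim L)"
proof -
  have g: "gram_det b (dim L) \<noteq> 0" and bL: "b ` {..<dim L} \<subseteq> L"
    using assms by (auto simp: primitive_system_def)
  have "inj_on b {..<dim L}" "independent (b ` {..<dim L})"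
    using g by (auto simp: independent_iff_gram_det[symmetric])
  then have "L \<subseteq> span (b ` {..<dim L})"
    using bL by (intro card_ge_dim_independent) (auto simp: card_image)
  then show ?thesis using assms by (auto simp: primitive_system_def lattice_basis_iff)
qed

lemma primitive_system_0: "add_subgroup L \<Longrightarrow> primitive_system L b 0"
  by (auto simp: primitive_system_def add_subgroup_def zspan_def)

lemma lattice_basis_exists:
  assumes L: "is_lattice L"
  shows "\<exists>b. lattice_basis L b (dim L)"
proof -
  have "\<exists>b. primitive_system L b k" if "k \<le> dim L" for k
    using that
  proof (induction k)
    case 0
    then show ?case using L primitive_system_0 by (auto simp: is_lattice_def)
  next
    case (Suc k)
    then obtain b where b: "primitive_system L b k" by auto
    have "card (b ` {..<k}) < dim L" using Suc.prems card_image_le[of "{..<k}" b] by simp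
    then obtain x where "x \<in> L" "x \<notin> span (b ` {..<k})" using exists_outside_span[of "b ` {..<k}" L] by blast
    then show ?case using primitive_system_extend[OF L b] by blast
  qed
  then show ?thesis using lattice_basis_of_primitive_system by blast
qed

text \<open>A size-reduced vector outside the span of \<open>b\<^sub>0, \<dots>, b\<^sub>k\<^sub>-\<^sub>1\<close> has squared norm at most \<open>(k + 1) / 4\<close> times that
  of the shortest such vector \<open>b\<^sub>k\<close>; for \<open>k < 3\<close> this is absurd, so the successive minima form a basis.\<close>
lemma minimal_basis_exists:
  assumes L: "is_lattice L" and dim: "dim L \<le> 3"
  shows "\<exists>b. lattice_basis L b (dim L) \<and>
    (\<forall>i<dim L. \<forall>z\<in>L - span (b ` {..<i}). norm (b i) \<le> norm z)"
proof -
  have "\<exists>b. primitive_system L b k \<and> (\<forall>i<k. \<forall>z\<in>L - span (b ` {..<i}). norm (b i) \<le> norm z)"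
    if "k \<le> dim L" for k
    using that
  proof (induction k)
    case 0
    then show ?case using L primitive_system_0 by (auto simp: is_lattice_def)
  next
    case (Suc k)
    then obtain b where b: "primitive_system L b k"
      and min: "\<And>i z. i < k \<Longrightarrow> z \<in> L - span (b ` {..<i}) \<Longrightarrow> norm (b i) \<le> norm z" by auto
    have "card (b ` {..<k}) < dim L" using Suc.prems card_image_le[of "{..<k}" b] by simp
    then obtain x where x: "x \<in> L" "x \<notin> span (b ` {..<k})" using exists_outside_span[of "b ` {..<k}" L] by blast
    define F where "F = {y \<in> L. norm y \<le> norm x} - span (b ` {..<k})"
    have "finite F" "x \<in> F" using finite_lattice_cball[OF L] x by (auto simp: F_def)
    then obtain y where y: "y \<in> F" "\<And>z. z \<in> F \<Longrightarrow> norm y \<le> norm z"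
      using arg_min_if_finite[of F norm] by (metis empty_iff not_le_imp_less)
    \<comment> \<open>Minimality within the finite set \<open>F\<close> suffices, since every vector
      left out by its norm bound is longer than \<open>x\<close>, which lies in
      \<open>F\<close>.\<close>
    have ymin: "norm y \<le> norm z" if "z \<in> L - span (b ` {..<k})" for z
      using y(2)[of z] y(2)[OF \<open>x \<in> F\<close>] that by (cases "norm z \<le> norm x") (auto simp: F_def)
    let ?b = "b(k := y)"
    have im: "?b ` {..<i} = b ` {..<i}" if "i \<le> k" for i using that by auto
    have nb: "norm (?b i) \<le> norm y" if "i < Suc k" for i
    proof (cases "i = k")
      case False
      then have "i < k" using that by simp
      moreover have "y \<in> L - span (b ` {..<i})"
        using y(1) span_mono[of "b ` {..<i}" "b ` {..<k}"] \<open>i < k\<close> by (force simp: F_def)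
      ultimately show ?thesis using min by simp
    qed simp
    have "primitive_system L ?b (Suc k)"
    proof (rule primitive_system_Suc)
      show "add_subgroup L" using L by (simp add: is_lattice_def)
      show "primitive_system L ?b k" using b primitive_system_cong[of k b ?b L] by auto
      show "?b k \<in> L" "?b k \<notin> span (?b ` {..<k})" using y by (auto simp: F_def im)
      fix z assume z: "z \<in> L" "z \<in> span (?b ` {..<Suc k})"
        "\<And>i. i < Suc k \<Longrightarrow> \<bar>inner z (gso ?b i)\<bar> \<le> inner (gso ?b i) (gso ?b i) / 2"
      show "z \<in> span (?b ` {..<k})"
      proof (rule ccontr)
        assume nz: "z \<notin> span (?b ` {..<k})"
        have "inner (gso ?b i) (gso ?b i) \<le> inner y y" if "i < Suc k" for i
          using gso_norm_le[of ?b i] nb[OF that] by (simp add: norm_le)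
        then have "(\<Sum>i<Suc k. inner (gso ?b i) (gso ?b i)) \<le> (\<Sum>i<Suc k. inner y y)"
          by (intro sum_mono) auto
        then have "inner z z \<le> real (Suc k) * inner y y / 4"
          using reduced_norm_le[OF z(2,3)] by simp
        moreover have "inner y y \<le> inner z z"
          using ymin[of z] z nz by (simp add: im norm_le)
        moreover have "real (Suc k) \<le> 3" using Suc.prems dim by simp
        moreover have "y \<noteq> 0" using y(1) by (auto simp: F_def span_zero)
        then have "inner y y > 0" by simp
        ultimately show False
          using mult_right_mono[of "real (Suc k)" 3 "inner y y"] by linarith
      qed
    qed
    moreover have "norm (?b i) \<le> norm z" if "i < Suc k" "z \<in> L - span (?b ` {..<i})" for i z
      using that ymin min by (cases "i = k") (auto simp: im)
    ultimately show ?case by blast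
  qed
  then show ?thesis using lattice_basis_of_primitive_system by blast
qed

subsection \<open>Tensor products of lattices\<close>

lemma bilinear_outer: "bilinear outer"
  unfolding bilinear_def outer_def
  by (auto intro!: linearI simp: Finite_Cartesian_Product.vec_eq_iff algebra_simps)

interpretation outer: bounded_bilinear outer
  using bilinear_outer by (simp add: bilinear_conv_bounded_bilinear)

lemma inner_outer: "inner (outer u v) (outer u' v') = inner u u' * inner v v'"
  by (simp add: outer_def inner_vec_def sum_product mult_ac) (rule sum.swap)

lemma add_subgroup_tensor_lat: "add_subgroup (tensor_lat L M)"
  unfolding tensor_lat_def add_subgroup_def by blast

lemma outer_in_tensor_lat: "u \<in> L \<Longrightarrow> v \<in> M \<Longrightarrow> outer u v \<in> tensor_lat L M"
  unfolding tensor_lat_def by blast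

lemma tensor_lat_least:
  "add_subgroup G \<Longrightarrow> (\<And>u v. u \<in> L \<Longrightarrow> v \<in> M \<Longrightarrow> outer u v \<in> G) \<Longrightarrow> tensor_lat L M \<subseteq> G"
  unfolding tensor_lat_def by blast

section \<open>Bases and slope of a tensor product\<close>

lemma mult_add_less:
  fixes i j m n :: nat
  assumes "i < n" "j < m"
  shows "i * m + j < n * m"
  using assms mult_le_mono1[of "Suc i" n m] by simp

text \<open>Lets one natural number index the tensor basis: the pair \<open>(i, j)\<close> has
  number \<open>i * m + j\<close>. For \<open>m = 0\<close> both sets are empty.\<close>

lemma bij_betw_div_mod:
  fixes m n :: nat
  shows "bij_betw (\<lambda>k. (k div m, k mod m)) {..<n * m} ({..<n} \<times> {..<m})"
proof (cases "m = 0")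
  case False
  then show ?thesis
    by (intro bij_betw_byWitness[where f' = "\<lambda>(i, j). i * m + j"])
      (auto simp: less_mult_imp_div_less intro: mult_add_less)
qed (simp add: bij_betw_def)

lemma sum_div_mod:
  fixes m n :: nat
  shows "(\<Sum>k<n * m. f (k div m) (k mod m)) = (\<Sum>i<n. \<Sum>j<m. f i j)"
  using sum.reindex_bij_betw[OF bij_betw_div_mod, of "\<lambda>(i, j). f i j" m n]
  by (simp add: sum.cartesian_product)

lemma prod_div_mod:
  fixes m n :: nat
  shows "(\<Prod>k<n * m. f (k div m) (k mod m)) = (\<Prod>i<n. \<Prod>j<m. f i j)"
  using prod.reindex_bij_betw[OF bij_betw_div_mod, of "\<lambda>(i, j). f i j" m n]
  by (simp add: prod.cartesian_product)

lemma outer_sum_sum: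
  "outer (\<Sum>i\<in>A. p i *\<^sub>R b i) (\<Sum>j\<in>B. q j *\<^sub>R c j) = (\<Sum>i\<in>A. \<Sum>j\<in>B. (p i * q j) *\<^sub>R outer (b i) (c j))"
  by (subst outer.sum_left)
    (simp add: outer.sum_right outer.scaleR_left outer.scaleR_right scaleR_sum_right mult.commute)

text \<open>The tensors of the two Gram-Schmidt families are pairwise orthogonal, and the passage to
  them is unitriangular in the lexicographic order of the index pairs.\<close>

lemma gram_det_tensor:
  "gram_det (\<lambda>k. outer (b (k div m)) (c (k mod m))) (n * m) = gram_det b n ^ m * gram_det c m ^ n"
proof (cases "m = 0")
  case False
  let ?D = "\<lambda>k. outer (gso b (k div m)) (gso c (k mod m))"
  let ?T = "\<lambda>k l. gso_coeff b (k div m) (l div m) * gso_coeff c (k mod m) (l mod m)"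
  have lt: "k div m < n" "k mod m < m" if "k < n * m" for k
    using that False by (auto simp: less_mult_imp_div_less)
  have "gram_det (\<lambda>k. outer (b (k div m)) (c (k mod m))) (n * m) = gram_det ?D (n * m)"
  proof (rule gram_det_unitriangular[where T = ?T])
    fix k assume k: "k < n * m"
    have "outer (b (k div m)) (c (k mod m)) = outer (\<Sum>i<n. gso_coeff b (k div m) i *\<^sub>R gso b i)
        (\<Sum>j<m. gso_coeff c (k mod m) j *\<^sub>R gso c j)"
      by (simp only: gso_expand[OF lt(1)[OF k], symmetric] gso_expand[OF lt(2)[OF k], symmetric])
    also have "\<dots> = (\<Sum>l<n * m. ?T k l *\<^sub>R ?D l)"
      unfolding outer_sum_sum by (rule sum_div_mod[symmetric])
    finally show "outer (b (k div m)) (c (k mod m)) = (\<Sum>l<n * m. ?T k l *\<^sub>R ?D l)" .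
  next
    \<comment> \<open>The order of the numbers is the lexicographic order of the pairs, so for
      \<open>k < l\<close> one of the two coefficients lies above the diagonal.\<close>
    have "?T k l = 0" if "k < l" for k l
    proof -
      have "k mod m < l mod m" if "k div m = l div m"
      proof -
        have "k div m * m + k mod m < l div m * m + l mod m"
          using \<open>k < l\<close> by (simp only: div_mult_mod_eq)
        then show ?thesis by (simp only: that add_less_cancel_left)
      qed
      moreover have "k div m \<le> l div m" using that by (simp add: div_le_mono)
      ultimately have "k div m < l div m \<or> k div m = l div m \<and> k mod m < l mod m" by linarith
      then show ?thesis by (auto simp: gso_coeff_def)
    qed
    then show "(\<forall>i<n * m. \<forall>j<n * m. i < j \<longrightarrow> ?T i j = 0) \<or> (\<forall>i<n * m. \<forall>j<n * m. j < i \<longrightarrow> ?T i j = 0)"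
      by blast
  qed (simp add: gso_coeff_def)
  also have "\<dots> = (\<Prod>k<n * m. inner (?D k) (?D k))"
  proof (rule gram_det_orthogonal)
    fix k l :: nat assume "k \<noteq> l"
    then have "k div m \<noteq> l div m \<or> k mod m \<noteq> l mod m" by (metis div_mult_mod_eq)
    then show "inner (?D k) (?D l) = 0" by (auto simp: inner_outer gso_orthogonal)
  qed
  also have "\<dots> = (\<Prod>i<n. \<Prod>j<m. inner (gso b i) (gso b i) * inner (gso c j) (gso c j))"
    unfolding inner_outer
    by (rule prod_div_mod[where f = "\<lambda>i j. inner (gso b i) (gso b i) * inner (gso c j) (gso c j)"])
  also have "\<dots> = gram_det b n ^ m * gram_det c m ^ n"
    by (simp add: gram_det_eq_prod_gso prod.distrib prod_power_distrib)
  finally show ?thesis .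
qed simp

lemma lattice_basis_tensor:
  assumes b: "lattice_basis L b n" and c: "lattice_basis M c m"
  shows "lattice_basis (tensor_lat L M) (\<lambda>k. outer (b (k div m)) (c (k mod m))) (n * m)"
  unfolding lattice_basis_iff
proof (intro conjI equalityI)
  let ?B = "\<lambda>k. outer (b (k div m)) (c (k mod m))"
  have L: "L = zspan b n" and M: "M = zspan c m" using b c by (auto simp: lattice_basis_iff)
  show "gram_det ?B (n * m) \<noteq> 0"
    using b c by (simp add: gram_det_tensor lattice_basis_iff)
  show "zspan ?B (n * m) \<subseteq> tensor_lat L M"
  proof (rule zspan_least[OF add_subgroup_tensor_lat])
    fix k assume k: "k < n * m"
    then have "0 < m" by (cases m) auto
    then show "?B k \<in> tensor_lat L M"
      unfolding L M using k by (intro outer_in_tensor_lat zspan_base) (auto simp: less_mult_imp_div_less)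
  qed
  show "tensor_lat L M \<subseteq> zspan ?B (n * m)"
  proof (rule tensor_lat_least[OF add_subgroup_zspan])
    fix u v assume "u \<in> L" "v \<in> M"
    then obtain p q :: "nat \<Rightarrow> int" where
      uv: "u = (\<Sum>i<n. of_int (p i) *\<^sub>R b i)" "v = (\<Sum>j<m. of_int (q j) *\<^sub>R c j)"
      by (auto simp: L M zspan_def)
    have "outer u v = (\<Sum>k<n * m. of_int (p (k div m) * q (k mod m)) *\<^sub>R ?B k)"
      unfolding uv outer_sum_sum
      by (subst sum_div_mod[where f = "\<lambda>i j. of_int (p i * q j) *\<^sub>R outer (b i) (c j)"]) simp
    also have "\<dots> \<in> zspan ?B (n * m)" by (rule zspan_sum)
    finally show "outer u v \<in> zspan ?B (n * m)" .
  qed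
qed

text \<open>Take logarithms in \<open>gram_det_tensor\<close> and divide by twice the rank. A factor
  of rank 0 is excluded because its slope is 0 by division by zero, and the tensor lattice would
  have slope 0 too.\<close>

lemma slope_tensor:
  assumes L: "is_lattice L" and M: "is_lattice M" and "dim L \<noteq> 0" "dim M \<noteq> 0"
  shows "slope (tensor_lat L M) = slope L + slope M"
proof -
  obtain b c where b: "lattice_basis L b (dim L)" and c: "lattice_basis M c (dim M)"
    using lattice_basis_exists L M by metis
  have "ln (gram_det b (dim L) ^ dim M * gram_det c (dim M) ^ dim L)
      = dim M * ln (gram_det b (dim L)) + dim L * ln (gram_det c (dim M))"
    using gram_det_basis_pos[OF b] gram_det_basis_pos[OF c] by (simp add: ln_mult ln_realpow)
  then show ?thesis
    unfolding slope_eq[OF lattice_basis_tensor[OF b c]] slope_eq[OF b] slope_eq[OF c] gram_det_tensor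
    using assms(3,4) by (simp add: field_simps)
qed

section \<open>Tensors as sums with the fewest pure terms\<close>

lemma tensor_lat_sum:
  fixes L :: "(real^'n) set" and M :: "(real^'m) set"
  assumes "add_subgroup L" and "x \<in> tensor_lat L M"
  shows "\<exists>(r::nat) u v. (\<forall>k<r. u k \<in> L) \<and> (\<forall>k<r. v k \<in> M) \<and> x = (\<Sum>k<r. outer (u k) (v k))"
proof -
  define G where "G = {x. \<exists>(r::nat) u v. (\<forall>k<r. u k \<in> L) \<and> (\<forall>k<r. v k \<in> M) \<and> x = (\<Sum>k<r. outer (u k) (v k))}"
  have "0 \<in> G" unfolding G_def by (auto intro!: exI[of _ "0::nat"])
  moreover have "- x \<in> G" if x: "x \<in> G" for x
  proof -
    obtain r :: nat and u v where x: "\<forall>k<r. u k \<in> L" "\<forall>k<r. v k \<in> M" "x = (\<Sum>k<r. outer (u k) (v k))"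
      using x unfolding G_def by blast
    have "- x = (\<Sum>k<r. outer (- u k) (v k))" by (simp add: x(3) outer.minus_left sum_negf)
    moreover have "\<forall>k<r. - u k \<in> L" using x assms(1) by (auto simp: add_subgroup_def)
    ultimately show ?thesis unfolding G_def using x(2)
      by (intro CollectI exI[of _ r] exI[of _ "\<lambda>k. - u k"] exI[of _ v]) auto
  qed
  moreover have "x + y \<in> G" if x: "x \<in> G" and y: "y \<in> G" for x y
  proof -
    obtain r :: nat and u v where x: "\<forall>k<r. u k \<in> L" "\<forall>k<r. v k \<in> M" "x = (\<Sum>k<r. outer (u k) (v k))"
      using x unfolding G_def by blast
    obtain r' :: nat and u' v' where y: "\<forall>k<r'. u' k \<in> L" "\<forall>k<r'. v' k \<in> M" "y = (\<Sum>k<r'. outer (u' k) (v' k))"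
      using y unfolding G_def by blast
    \<comment> \<open>The two lists of terms are concatenated.\<close>
    let ?u = "\<lambda>k. if k < r then u k else u' (k - r)" and ?v = "\<lambda>k. if k < r then v k else v' (k - r)"
    have split: "(\<Sum>k<r + s. f k) = (\<Sum>k<r. f k) + (\<Sum>k<s. f (r + k))" for f :: "nat \<Rightarrow> real^'m^'n" and s
      by (induction s) (auto simp: add.assoc)
    have "x + y = (\<Sum>k<r + r'. outer (?u k) (?v k))" unfolding split by (simp add: x y)
    moreover have "\<forall>k<r + r'. ?u k \<in> L" "\<forall>k<r + r'. ?v k \<in> M" using x y by auto
    ultimately show ?thesis unfolding G_def
      by (intro CollectI exI[of _ "r + r'"] exI[of _ ?u] exI[of _ ?v]) blast
  qed
  ultimately have "add_subgroup G" by (auto simp: add_subgroup_def)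
  moreover have "outer u v \<in> G" if "u \<in> L" "v \<in> M" for u v
    unfolding G_def using that
    by (intro CollectI exI[of _ 1] exI[of _ "\<lambda>_. u"] exI[of _ "\<lambda>_. v"]) auto
  ultimately show ?thesis using tensor_lat_least[of G L M] assms(2) unfolding G_def by blast
qed

text \<open>The integer span of the \<open>u k\<close> is a sublattice of \<open>L\<close>, hence
  has a basis \<open>w\<close>. With \<open>r\<close> elements, \<open>w\<close> would be an
  integral transform of \<open>u\<close>, and its Gram determinant would vanish together with that
  of \<open>u\<close>.\<close>

lemma dependent_zspan_shorter:
  assumes L: "is_lattice L" and u: "\<And>k. k < r \<Longrightarrow> u k \<in> L" and g: "gram_det u r = 0"
  shows "\<exists>s w. s < r \<and> (\<forall>j<s. w j \<in> L) \<and> (\<forall>k<r. u k \<in> zspan w s)"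
proof -
  have sub: "zspan u r \<subseteq> L" using L u by (intro zspan_least) (auto simp: is_lattice_def)
  obtain w where w: "lattice_basis (zspan u r) w (dim (zspan u r))"
    using lattice_basis_exists[OF is_lattice_subgroup[OF L add_subgroup_zspan sub]] by blast
  define s where "s = dim (zspan u r)"
  have ws: "gram_det w s \<noteq> 0" "zspan u r = zspan w s"
    using w by (auto simp: s_def lattice_basis_iff)
  have "s = dim (u ` {..<r})" unfolding s_def by (metis dim_span span_zspan)
  also have "\<dots> \<le> card (u ` {..<r})" by (rule dim_le_card') simp
  also have "\<dots> \<le> r" using card_image_le[of "{..<r}" u] by simp
  finally have "s \<le> r" .
  moreover have "s \<noteq> r"
  proof
    assume "s = r"
    have "\<forall>i. \<exists>t::nat \<Rightarrow> int. i < r \<longrightarrow> w i = (\<Sum>j<r. of_int (t j) *\<^sub>R u j)"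
      using zspan_base[of _ r w] ws(2) \<open>s = r\<close> by (auto simp: zspan_def)
    then obtain T :: "nat \<Rightarrow> nat \<Rightarrow> int" where
      "\<And>i. i < r \<Longrightarrow> w i = (\<Sum>j<r. of_int (T i j) *\<^sub>R u j)" by metis
    from gram_det_transform[of r w "\<lambda>i j. of_int (T i j)" u, OF this] show False
      using g ws(1) \<open>s = r\<close> by simp
  qed
  ultimately have "s < r" by simp
  moreover have "w j \<in> L" if "j < s" for j using zspan_base[OF that, of w] ws(2) sub by blast
  moreover have "u k \<in> zspan w s" if "k < r" for k using zspan_base[OF that, of u] ws(2) by simp
  ultimately show ?thesis by blast
qed

text \<open>Expand the left factors in the shorter family and collect the right factors by
  bilinearity. Stated for a general \<open>f\<close> so that the flipped tensor product shortens
  dependent right factors as well.\<close>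

lemma bilinear_sum_shorter:
  fixes f :: "'a::euclidean_space \<Rightarrow> 'b::euclidean_space \<Rightarrow> 'c::euclidean_space"
  assumes f: "bounded_bilinear f" and L: "is_lattice L" and M: "add_subgroup M"
    and u: "\<forall>k<r. u k \<in> L" and v: "\<forall>k<r. v k \<in> M" and g: "gram_det u r = 0"
  shows "\<exists>s w y. s < r \<and> (\<forall>k<s. w k \<in> L) \<and> (\<forall>k<s. y k \<in> M) \<and>
    (\<Sum>k<r. f (u k) (v k)) = (\<Sum>k<s. f (w k) (y k))"
proof -
  interpret f: bounded_bilinear f by fact
  obtain s w where s: "s < r" "\<And>j. j < s \<Longrightarrow> w j \<in> L" "\<And>k. k < r \<Longrightarrow> u k \<in> zspan w s"
    using dependent_zspan_shorter[OF L _ g] u by blast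
  have "\<forall>k. \<exists>t::nat \<Rightarrow> int. k < r \<longrightarrow> u k = (\<Sum>j<s. of_int (t j) *\<^sub>R w j)"
    using s(3) by (auto simp: zspan_def)
  then obtain T :: "nat \<Rightarrow> nat \<Rightarrow> int" where
    T: "\<And>k. k < r \<Longrightarrow> u k = (\<Sum>j<s. of_int (T k j) *\<^sub>R w j)" by metis
  define y where "y j = (\<Sum>k<r. of_int (T k j) *\<^sub>R v k)" for j
  have "(\<Sum>k<r. f (u k) (v k)) = (\<Sum>k<r. \<Sum>j<s. of_int (T k j) *\<^sub>R f (w j) (v k))"
    by (simp add: T f.sum_left f.scaleR_left)
  also have "\<dots> = (\<Sum>j<s. f (w j) (y j))"
    by (subst sum.swap) (simp add: y_def f.sum_right f.scaleR_right)
  finally have "(\<Sum>k<r. f (u k) (v k)) = (\<Sum>j<s. f (w j) (y j))" .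
  moreover have "y j \<in> M" for j
    unfolding y_def using M v by (intro add_subgroup_sum add_subgroup_scale_int) auto
  ultimately show ?thesis using s by blast
qed

text \<open>A representation with the fewest terms will do, since a dependence on either side would
  shorten it.\<close>

lemma tensor_lat_independent_sum:
  assumes L: "is_lattice L" and M: "is_lattice M" and x: "x \<in> tensor_lat L M"
  shows "\<exists>(r::nat) u v. (\<forall>k<r. u k \<in> L) \<and> (\<forall>k<r. v k \<in> M) \<and> x = (\<Sum>k<r. outer (u k) (v k)) \<and>
    gram_det u r \<noteq> 0 \<and> gram_det v r \<noteq> 0"
proof -
  have sL: "add_subgroup L" and sM: "add_subgroup M" using L M by (auto simp: is_lattice_def)
  define P where "P r \<longleftrightarrow> (\<exists>u v. (\<forall>k<r. u k \<in> L) \<and> (\<forall>k<r. v k \<in> M) \<and> x = (\<Sum>k<r. outer (u k) (v k)))" for r :: nat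
  have "\<exists>r. P r" unfolding P_def by (rule tensor_lat_sum[OF sL x])
  then obtain r where "P r" and min: "\<And>s. s < r \<Longrightarrow> \<not> P s" using exists_least_iff[of P] by blast
  then obtain u v where uv: "\<forall>k<r. u k \<in> L" "\<forall>k<r. v k \<in> M" "x = (\<Sum>k<r. outer (u k) (v k))"
    unfolding P_def by blast
  have "gram_det u r \<noteq> 0"
  proof
    assume "gram_det u r = 0"
    from bilinear_sum_shorter[OF outer.bounded_bilinear_axioms L sM uv(1,2) this]
    obtain s w y where "s < r" "\<forall>k<s. w k \<in> L" "\<forall>k<s. y k \<in> M" "x = (\<Sum>k<s. outer (w k) (y k))"
      unfolding uv(3) by blast
    then show False using min unfolding P_def by blast
  qed
  moreover have "gram_det v r \<noteq> 0"
  proof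
    assume "gram_det v r = 0"
    from bilinear_sum_shorter[OF outer.flip M sL uv(2,1) this]
    obtain s w y where "s < r" "\<forall>k<s. w k \<in> M" "\<forall>k<s. y k \<in> L" "x = (\<Sum>k<s. outer (y k) (w k))"
      unfolding uv(3) by blast
    then show False using min unfolding P_def by blast
  qed
  ultimately show ?thesis using uv by blast
qed

text \<open>The squared norm is the trace of the product of the two Gram matrices; orthogonalising the
  left factors reduces its lower bound to Hadamard's inequality and AM-GM.\<close>
lemma norm_sum_outer_ge:
  fixes a b :: real
  assumes a: "0 < a" "a ^ r \<le> gram_det u r" and b: "0 < b" "b ^ r \<le> gram_det v r"
  shows "real r * (a * b) \<le> inner (\<Sum>k<r. outer (u k) (v k)) (\<Sum>k<r. outer (u k) (v k))"
proof (cases "r = 0")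
  case False
  \<comment> \<open>The Gram-Schmidt coefficients move from the left factors to the right ones. This
    acts on \<open>v\<close> by the transposed unitriangular matrix and keeps its Gram
    determinant.\<close>
  define v' where "v' j = (\<Sum>k<r. gso_coeff u k j *\<^sub>R v k)" for j
  define h where "h j = inner (gso u j) (gso u j) * inner (v' j) (v' j)" for j
  have "(\<Sum>k<r. outer (u k) (v k)) = (\<Sum>k<r. outer (\<Sum>j<r. gso_coeff u k j *\<^sub>R gso u j) (v k))"
    by (rule sum.cong) (auto simp: gso_expand[symmetric])
  also have "\<dots> = (\<Sum>j<r. outer (gso u j) (v' j))"
    unfolding v'_def outer.sum_left outer.sum_right outer.scaleR_left outer.scaleR_right
    by (rule sum.swap)
  finally have x: "(\<Sum>k<r. outer (u k) (v k)) = (\<Sum>j<r. outer (gso u j) (v' j))" .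
  have "inner (\<Sum>k<r. outer (u k) (v k)) (\<Sum>k<r. outer (u k) (v k))
      = (\<Sum>i<r. \<Sum>j<r. inner (gso u i) (gso u j) * inner (v' i) (v' j))"
    unfolding x by (simp add: inner_sum_left inner_sum_right inner_outer) (rule sum.swap)
  also have "\<dots> = (\<Sum>i<r. \<Sum>j<r. if j = i then h i else 0)"
    by (intro sum.cong) (auto simp: h_def gso_orthogonal)
  also have "\<dots> = (\<Sum>i<r. h i)" by simp
  finally have norm: "inner (\<Sum>k<r. outer (u k) (v k)) (\<Sum>k<r. outer (u k) (v k)) = (\<Sum>i<r. h i)" .
  have "gram_det v' r = gram_det v r"
    by (rule gram_det_unitriangular[where T = "\<lambda>j k. gso_coeff u k j"]) (auto simp: v'_def gso_coeff_def)
  then have "gram_det v r \<le> (\<Prod>i<r. inner (v' i) (v' i))" using hadamard[of v' r] by simp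
  then have "b ^ r \<le> (\<Prod>i<r. inner (v' i) (v' i))" using b by simp
  then have "a ^ r * b ^ r \<le> (\<Prod>i<r. inner (gso u i) (gso u i)) * (\<Prod>i<r. inner (v' i) (v' i))"
    using a b unfolding gram_det_eq_prod_gso by (intro mult_mono) (auto intro: prod_nonneg)
  then have "(a * b) ^ r \<le> (\<Prod>i<r. h i)" by (simp add: h_def prod.distrib power_mult_distrib)
  then have "((a * b) ^ r) powr (1 / real r) \<le> (\<Prod>i<r. h i) powr (1 / real r)"
    using a b by (intro powr_mono2) auto
  moreover have "((a * b) ^ r) powr (1 / real r) = a * b"
    using a b False by (simp add: powr_realpow[symmetric] powr_powr)
  moreover have "(\<Prod>i<r. h i) powr (1 / real r) \<le> (\<Sum>i<r. h i / real r)"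
    using arith_geom_mean[of "{..<r}" h] False by (simp add: h_def lessThan_empty_iff)
  ultimately have "a * b \<le> (\<Sum>i<r. h i) / real r" by (simp add: sum_divide_distrib)
  then show ?thesis unfolding norm using False by (simp add: field_simps)
qed simp

lemma tensor_lat_norm_ge:
  assumes L: "semistable L" and M: "semistable M" and x: "x \<in> tensor_lat L M" "x \<noteq> 0"
  defines "t \<equiv> exp (- 2 * slope L) * exp (- 2 * slope M)"
  shows "t \<le> inner x x"
    and "inner x x < 2 * t \<Longrightarrow> \<exists>u\<in>L. \<exists>v\<in>M. x = outer u v"
proof -
  obtain r :: nat and u v where uv: "\<And>k. k < r \<Longrightarrow> u k \<in> L" "\<And>k. k < r \<Longrightarrow> v k \<in> M"
    "x = (\<Sum>k<r. outer (u k) (v k))" "gram_det u r \<noteq> 0" "gram_det v r \<noteq> 0"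
    using tensor_lat_independent_sum[of L M x] L M x(1) unfolding semistable_def by blast
  have ge: "real r * t \<le> inner x x"
    unfolding uv(3) t_def
    by (rule norm_sum_outer_ge)
      (use semistable_gram_det_ge[OF L uv(1,4)] semistable_gram_det_ge[OF M uv(2,5)] in auto)
  have t: "t > 0" by (simp add: t_def)
  have "r \<noteq> 0" using uv(3) x(2) by (intro notI) simp
  then have "1 \<le> real r" by simp
  then have "1 * t \<le> real r * t" using t by (intro mult_right_mono) auto
  then show "t \<le> inner x x" using ge by linarith
  assume "inner x x < 2 * t"
  then have "real r * t < 2 * t" using ge by linarith
  then have "r < 2" using t by simp
  then have "r = 1" using \<open>r \<noteq> 0\<close> by simp
  then show "\<exists>u\<in>L. \<exists>v\<in>M. x = outer u v" using uv by auto
qed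

subsection \<open>Gram matrices of rank at most three\<close>

lemma gram_det_1: "gram_det b 1 = inner (b 0) (b 0)"
  by (simp add: gram_det_eq_prod_gso gso.simps[of b 0])

lemma gram_det_2: "gram_det b 2 = inner (b 0) (b 0) * inner (b 1) (b 1) - (inner (b 0) (b 1))\<^sup>2"
proof -
  have e: "{..<2} = insert 0 {1::nat}" by auto
  have f: "finite {1::nat}" "0 \<notin> {1::nat}" by auto
  show ?thesis
    unfolding gram_det_def e sum_over_permutations_insert[OF f] permutes_sing
    by (simp add: sign_swap_id sign_id swap_id_eq power2_eq_square inner_commute)
qed

text \<open>The determinant of a symmetric 3 x 3 matrix with diagonal \<open>g0\<close>,
  \<open>g1\<close>, \<open>g2\<close>, expanded so that the identities below become polynomial
  ones.\<close>

definition det_sym3 :: "real \<Rightarrow> real \<Rightarrow> real \<Rightarrow> real \<Rightarrow> real \<Rightarrow> real \<Rightarrow> real" where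
  "det_sym3 g0 g1 g2 g01 g02 g12 =
     g0 * g1 * g2 + 2 * g01 * g12 * g02 - g0 * g12\<^sup>2 - g1 * g02\<^sup>2 - g2 * g01\<^sup>2"

lemma gram_det_3:
  "gram_det b 3 = det_sym3 (inner (b 0) (b 0)) (inner (b 1) (b 1)) (inner (b 2) (b 2))
     (inner (b 0) (b 1)) (inner (b 0) (b 2)) (inner (b 1) (b 2))"
proof -
  have e: "{..<3} = insert 0 (insert 1 {2::nat})" by auto
  have f: "finite {1, 2::nat}" "0 \<notin> {1, 2::nat}" "finite {2::nat}" "1 \<notin> {2::nat}" by auto
  show ?thesis
    unfolding gram_det_def e sum_over_permutations_insert[OF f(1,2)]
      sum_over_permutations_insert[OF f(3,4)] permutes_sing det_sym3_def
    by (simp add: sign_swap_id permutation_swap_id sign_compose sign_id swap_id_eq power2_eq_square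
        inner_commute algebra_simps)
qed

text \<open>A case of Oppenheim's inequality. The tensor \<open>w\<close> of \<open>gso u i\<close>
  and \<open>v i\<close> is orthogonal to all earlier tensors and has inner product
  \<open>inner w w\<close> with the \<open>i\<close>-th one. By Cauchy-Schwarz the
  \<open>i\<close>-th Gram-Schmidt vector of the tensors is at least as long as
  \<open>w\<close>.\<close>

lemma gram_det_outer_ge:
  "gram_det u r * (\<Prod>i<r. inner (v i) (v i)) \<le> gram_det (\<lambda>i. outer (u i) (v i)) r"
proof -
  let ?x = "\<lambda>i. outer (u i) (v i)"
  have "inner (gso u i) (gso u i) * inner (v i) (v i) \<le> inner (gso ?x i) (gso ?x i)" for i
  proof -
    define w where "w = outer (gso u i) (v i)"
    have "real_inner_class.orthogonal w (?x i - gso ?x i)"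
    proof (rule orthogonal_to_span)
      show "?x i - gso ?x i \<in> span (?x ` {..<i})"
        using diff_gso_in_span[of ?x i] by (simp only: span_gso)
      show "real_inner_class.orthogonal w y" if "y \<in> ?x ` {..<i}" for y
        using that by (auto simp: w_def real_inner_class.orthogonal_def inner_outer inner_gso_lower inner_commute[of "gso u i"])
    qed
    then have eq: "inner w (gso ?x i) = inner w w"
      by (simp add: real_inner_class.orthogonal_def inner_diff_right w_def inner_outer
          inner_commute[of "gso u i" "u i"] inner_gso_self)
    have "inner w w \<le> inner (gso ?x i) (gso ?x i)"
    proof (cases "w = 0")
      case False
      then show ?thesis
        using Cauchy_Schwarz_ineq[of w "gso ?x i"] by (simp add: eq power2_eq_square)
    qed simp
    then show ?thesis by (simp add: w_def inner_outer)
  qed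
  then show ?thesis
    unfolding gram_det_eq_prod_gso prod.distrib[symmetric] by (intro prod_mono) auto
qed

lemma gram_det_outer_commute:
  "gram_det (\<lambda>i. outer (u i) (v i)) r = gram_det (\<lambda>i. outer (v i) (u i)) r"
  by (simp add: gram_det_def inner_outer mult.commute)

text \<open>One of the three Gram-Schmidt vectors vanishes; coordinates along the other two, scaled
  by their norms, reproduce all inner products.\<close>

lemma planar_coordinates:
  assumes "gram_det u 3 = 0"
  shows "\<exists>a b :: nat \<Rightarrow> real. \<forall>i<3. \<forall>j<3. inner (u i) (u j) = a i * a j + b i * b j"
proof -
  have inn: "inner (u i) (u j) = (\<Sum>k<3. gso_coeff u i k * gso_coeff u j k * (norm (gso u k))\<^sup>2)"
    if "i < 3" "j < 3" for i j
  proof -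
    have "inner (u i) (u j) = (\<Sum>l<3. \<Sum>k<3. gso_coeff u i l * gso_coeff u j k * inner (gso u l) (gso u k))"
      by (subst gso_expand[OF that(1), of u], subst gso_expand[OF that(2), of u])
        (simp add: inner_sum_left inner_sum_right sum_distrib_left mult.assoc, subst sum.swap,
          simp add: mult.left_commute)
    also have "\<dots> = (\<Sum>l<3. \<Sum>k<3. if k = l then gso_coeff u i l * gso_coeff u j l * (norm (gso u l))\<^sup>2 else 0)"
      by (intro sum.cong) (auto simp: gso_orthogonal power2_norm_eq_inner)
    finally show ?thesis by simp
  qed
  obtain l where l: "l < 3" "gso u l = 0" using assms by (auto simp: gram_det_eq_prod_gso)
  obtain p q where pq: "{..<3} - {l} = {p, q}" "p \<noteq> q"
  proof -
    consider "l = 0" | "l = 1" | "l = 2" using l(1) by linarith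
    then show ?thesis
      by cases (rule that[of 1 2], auto, rule that[of 0 2], auto, rule that[of 0 1], auto)
  qed
  have planar: "inner (u i) (u j) = (gso_coeff u i p * norm (gso u p)) * (gso_coeff u j p * norm (gso u p))
      + (gso_coeff u i q * norm (gso u q)) * (gso_coeff u j q * norm (gso u q))"
    if "i < 3" "j < 3" for i j
  proof -
    have "inner (u i) (u j) = (\<Sum>k\<in>{..<3} - {l}. gso_coeff u i k * gso_coeff u j k * (norm (gso u k))\<^sup>2)"
      unfolding inn[OF that] using l by (subst sum.remove[of _ l]) auto
    then show ?thesis unfolding pq(1) using pq(2) by (simp add: power2_eq_square mult_ac)
  qed
  show ?thesis
    by (rule exI[of _ "\<lambda>i. gso_coeff u i p * norm (gso u p)"],
        rule exI[of _ "\<lambda>i. gso_coeff u i q * norm (gso u q)"], intro allI impI, rule planar)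
qed

text \<open>The rows \<open>(a c, a e, b c, b e)\<close> of the tensors lie on the quadric \<open>z\<^sub>1 z\<^sub>4 = z\<^sub>2 z\<^sub>3\<close>. By Cauchy--Binet
  the determinant is the sum of the squares of the four maximal minors, and the dual quadratic form
  evaluated at these minors is the product of all the \<open>2 \<times> 2\<close> determinants of the factors.\<close>
lemma det_sym3_tensor_ge:
  fixes a0 a1 a2 b0 b1 b2 c0 c1 c2 e0 e1 e2 :: real
  shows "2 * \<bar>(a0 * b1 - a1 * b0) * (a0 * b2 - a2 * b0) * (a1 * b2 - a2 * b1) *
      ((c0 * e1 - c1 * e0) * (c0 * e2 - c2 * e0) * (c1 * e2 - c2 * e1))\<bar>
    \<le> det_sym3 ((a0 * a0 + b0 * b0) * (c0 * c0 + e0 * e0)) ((a1 * a1 + b1 * b1) * (c1 * c1 + e1 * e1))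
        ((a2 * a2 + b2 * b2) * (c2 * c2 + e2 * e2)) ((a0 * a1 + b0 * b1) * (c0 * c1 + e0 * e1))
        ((a0 * a2 + b0 * b2) * (c0 * c2 + e0 * e2)) ((a1 * a2 + b1 * b2) * (c1 * c2 + e1 * e2))"
    (is "2 * \<bar>?P\<bar> \<le> ?D")
proof -
  define m where "m x0 y0 z0 x1 y1 z1 x2 y2 z2 =
      x0 * (y1 * z2 - y2 * z1) - y0 * (x1 * z2 - x2 * z1) + z0 * (x1 * y2 - x2 * y1)"
    for x0 y0 z0 x1 y1 z1 x2 y2 z2 :: real
  define N1 where "N1 = m (a0 * e0) (b0 * c0) (b0 * e0) (a1 * e1) (b1 * c1) (b1 * e1) (a2 * e2) (b2 * c2) (b2 * e2)"
  define N2 where "N2 = m (a0 * c0) (b0 * c0) (b0 * e0) (a1 * c1) (b1 * c1) (b1 * e1) (a2 * c2) (b2 * c2) (b2 * e2)"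
  define N3 where "N3 = m (a0 * c0) (a0 * e0) (b0 * e0) (a1 * c1) (a1 * e1) (b1 * e1) (a2 * c2) (a2 * e2) (b2 * e2)"
  define N4 where "N4 = m (a0 * c0) (a0 * e0) (b0 * c0) (a1 * c1) (a1 * e1) (b1 * c1) (a2 * c2) (a2 * e2) (b2 * c2)"
  have cauchy_binet: "det_sym3 (x0 * x0 + y0 * y0 + z0 * z0 + w0 * w0) (x1 * x1 + y1 * y1 + z1 * z1 + w1 * w1)
      (x2 * x2 + y2 * y2 + z2 * z2 + w2 * w2) (x0 * x1 + y0 * y1 + z0 * z1 + w0 * w1)
      (x0 * x2 + y0 * y2 + z0 * z2 + w0 * w2) (x1 * x2 + y1 * y2 + z1 * z2 + w1 * w2)
    = (m y0 z0 w0 y1 z1 w1 y2 z2 w2)\<^sup>2 + (m x0 z0 w0 x1 z1 w1 x2 z2 w2)\<^sup>2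
      + (m x0 y0 w0 x1 y1 w1 x2 y2 w2)\<^sup>2 + (m x0 y0 z0 x1 y1 z1 x2 y2 z2)\<^sup>2"
    for x0 y0 z0 w0 x1 y1 z1 w1 x2 y2 z2 w2
    unfolding m_def det_sym3_def by (simp add: power2_eq_square algebra_simps)
  have split: "(a * a' + b * b') * (c * c' + e * e') =
      (a * c) * (a' * c') + (a * e) * (a' * e') + (b * c) * (b' * c') + (b * e) * (b' * e')"
    for a b c e a' b' c' e' :: real by (simp add: algebra_simps)
  have D: "?D = N1\<^sup>2 + N2\<^sup>2 + N3\<^sup>2 + N4\<^sup>2"
    unfolding N1_def N2_def N3_def N4_def split by (rule cauchy_binet)
  have P: "N1 * N4 - N2 * N3 = - ?P"
    unfolding N1_def N2_def N3_def N4_def m_def by (simp add: algebra_simps)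
  have "2 * \<bar>N1 * N4\<bar> \<le> N1\<^sup>2 + N4\<^sup>2" "2 * \<bar>N2 * N3\<bar> \<le> N2\<^sup>2 + N3\<^sup>2"
    using sum_squares_bound[of "\<bar>N1\<bar>" "\<bar>N4\<bar>"] sum_squares_bound[of "\<bar>N2\<bar>" "\<bar>N3\<bar>"]
    by (simp_all add: abs_mult)
  then show ?thesis using P abs_triangle_ineq4[of "N1 * N4" "N2 * N3"] unfolding D by auto
qed

text \<open>Put ui = (ai, bi) and vi = (ci, ei), with u1 parallel to u0. If v0 and v1 are
  independent, the first two tensors span the tensor product of the line of u0 with the plane. The
  formula is their Gram determinant times the squared distance of the third tensor from that
  span.\<close>

lemma det_sym3_tensor_parallel:
  fixes a0 a1 a2 b0 b1 b2 c0 c1 c2 e0 e1 e2 :: real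
  assumes par: "a0 * b1 - a1 * b0 = 0" and pos: "a0 * a0 + b0 * b0 > 0"
  shows "det_sym3 ((a0 * a0 + b0 * b0) * (c0 * c0 + e0 * e0)) ((a1 * a1 + b1 * b1) * (c1 * c1 + e1 * e1))
        ((a2 * a2 + b2 * b2) * (c2 * c2 + e2 * e2)) ((a0 * a1 + b0 * b1) * (c0 * c1 + e0 * e1))
        ((a0 * a2 + b0 * b2) * (c0 * c2 + e0 * e2)) ((a1 * a2 + b1 * b2) * (c1 * c2 + e1 * e2))
    = (a1 * a1 + b1 * b1) * (c0 * e1 - c1 * e0)\<^sup>2 * (a0 * b2 - a2 * b0)\<^sup>2 * (c2 * c2 + e2 * e2)"
proof -
  define l where "l = (a0 * a1 + b0 * b1) / (a0 * a0 + b0 * b0)"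
  \<comment> \<open>The vector u1 is split into its components along u0 and perpendicular to u0; the
    latter vanishes by \<open>par\<close>.\<close>
  have "a1 * (a0 * a0 + b0 * b0) = (a0 * a1 + b0 * b1) * a0 - b0 * (a0 * b1 - a1 * b0)"
    "b1 * (a0 * a0 + b0 * b0) = (a0 * a1 + b0 * b1) * b0 + a0 * (a0 * b1 - a1 * b0)"
    by (simp_all add: algebra_simps)
  then have "a1 * (a0 * a0 + b0 * b0) = (a0 * a1 + b0 * b1) * a0" "b1 * (a0 * a0 + b0 * b0) = (a0 * a1 + b0 * b1) * b0"
    unfolding par by simp_all
  then have l: "a1 = l * a0" "b1 = l * b0"
    using pos unfolding l_def times_divide_eq_left eq_divide_eq by auto
  show ?thesis unfolding l det_sym3_def by (simp add: power2_eq_square algebra_simps)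
qed

text \<open>The Gram determinant of three pure tensors in planar coordinates. The indices are
  arguments so that the symmetry under rotating them can be stated.\<close>

definition det_tensor3 :: "(nat \<Rightarrow> real) \<Rightarrow> (nat \<Rightarrow> real) \<Rightarrow> (nat \<Rightarrow> real) \<Rightarrow> (nat \<Rightarrow> real) \<Rightarrow> nat \<Rightarrow> nat \<Rightarrow> nat \<Rightarrow> real" where
  "det_tensor3 a b c e i j k =
    det_sym3 ((a i * a i + b i * b i) * (c i * c i + e i * e i)) ((a j * a j + b j * b j) * (c j * c j + e j * e j))
        ((a k * a k + b k * b k) * (c k * c k + e k * e k)) ((a i * a j + b i * b j) * (c i * c j + e i * e j))
        ((a i * a k + b i * b k) * (c i * c k + e i * e k)) ((a j * a k + b j * b k) * (c j * c k + e j * e k))"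

lemma det_tensor3_rotate: "det_tensor3 a b c e i j k = det_tensor3 a b c e j k i"
  unfolding det_tensor3_def det_sym3_def by (simp add: mult.commute)

lemma det_tensor3_swap: "det_tensor3 a b c e i j k = det_tensor3 c e a b i j k"
  unfolding det_tensor3_def by (simp add: mult.commute)

text \<open>In the closed form each factor has its own bound: the two squared lengths by \<alpha>
  and \<beta>, the two squared minors by their squares. The minors are nonzero because the
  determinant is.\<close>

lemma det_tensor3_ge_parallel:
  fixes \<alpha> \<beta> :: real
  assumes \<alpha>: "0 < \<alpha>" and \<beta>: "0 < \<beta>"
    and A: "\<alpha> \<le> a i * a i + b i * b i" "\<alpha> \<le> a j * a j + b j * b j"
    and C: "\<beta> \<le> c k * c k + e k * e k"
    and p: "a i * b k - a k * b i \<noteq> 0 \<Longrightarrow> \<alpha>\<^sup>2 \<le> (a i * b k - a k * b i)\<^sup>2"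
    and q: "c i * e j - c j * e i \<noteq> 0 \<Longrightarrow> \<beta>\<^sup>2 \<le> (c i * e j - c j * e i)\<^sup>2"
    and D: "det_tensor3 a b c e i j k \<noteq> 0" and par: "a i * b j - a j * b i = 0"
  shows "(\<alpha> * \<beta>) ^ 3 \<le> det_tensor3 a b c e i j k"
proof -
  have eq: "det_tensor3 a b c e i j k = (a j * a j + b j * b j) * (c i * e j - c j * e i)\<^sup>2
      * (a i * b k - a k * b i)\<^sup>2 * (c k * c k + e k * e k)"
    unfolding det_tensor3_def by (rule det_sym3_tensor_parallel[OF par]) (use A \<alpha> in linarith)
  then have nz: "c i * e j - c j * e i \<noteq> 0" "a i * b k - a k * b i \<noteq> 0" using D by auto
  have "(\<alpha> * \<beta>) ^ 3 = \<alpha> * \<beta>\<^sup>2 * \<alpha>\<^sup>2 * \<beta>" by (simp add: power2_eq_square power3_eq_cube)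
  also have "\<dots> \<le> det_tensor3 a b c e i j k"
    unfolding eq using A(2) C p[OF nz(2)] q[OF nz(1)] \<alpha> \<beta> by (intro mult_mono) auto
  finally show ?thesis .
qed

text \<open>If a minor vanishes, rotating the indices or exchanging the factors reduces to
  \<open>det_tensor3_ge_parallel\<close>. Otherwise all six minors are bounded below, and
  \<open>det_sym3_tensor_ge\<close> gives the claim with a factor 2 to spare.\<close>

lemma det_tensor3_ge:
  fixes \<alpha> \<beta> :: real
  assumes \<alpha>: "0 < \<alpha>" and \<beta>: "0 < \<beta>"
    and A: "\<And>i. i < 3 \<Longrightarrow> \<alpha> \<le> a i * a i + b i * b i"
    and C: "\<And>i. i < 3 \<Longrightarrow> \<beta> \<le> c i * c i + e i * e i"
    and p: "\<And>i j. i < 3 \<Longrightarrow> j < 3 \<Longrightarrow> a i * b j - a j * b i \<noteq> 0 \<Longrightarrow> \<alpha>\<^sup>2 \<le> (a i * b j - a j * b i)\<^sup>2"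
    and q: "\<And>i j. i < 3 \<Longrightarrow> j < 3 \<Longrightarrow> c i * e j - c j * e i \<noteq> 0 \<Longrightarrow> \<beta>\<^sup>2 \<le> (c i * e j - c j * e i)\<^sup>2"
    and D: "det_tensor3 a b c e 0 1 2 \<noteq> 0"
  shows "(\<alpha> * \<beta>) ^ 3 \<le> det_tensor3 a b c e 0 1 2"
proof -
  let ?D = "det_tensor3 a b c e 0 1 2"
  have r: "det_tensor3 a b c e 1 2 0 = ?D" "det_tensor3 a b c e 2 0 1 = ?D"
    "det_tensor3 c e a b 0 1 2 = ?D" "det_tensor3 c e a b 1 2 0 = ?D" "det_tensor3 c e a b 2 0 1 = ?D"
    using det_tensor3_rotate det_tensor3_swap by metis+
  have par: "(\<alpha> * \<beta>) ^ 3 \<le> ?D"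
    if "i < 3" "j < 3" "k < 3" "det_tensor3 a b c e i j k = ?D" "a i * b j - a j * b i = 0" for i j k
    using det_tensor3_ge_parallel[OF \<alpha> \<beta> A[OF that(1)] A[OF that(2)] C[OF that(3)] p[OF that(1,3)] q[OF that(1,2)] _ that(5)]
      D that(4) by simp
  have par': "(\<alpha> * \<beta>) ^ 3 \<le> ?D"
    if "i < 3" "j < 3" "k < 3" "det_tensor3 c e a b i j k = ?D" "c i * e j - c j * e i = 0" for i j k
    using det_tensor3_ge_parallel[OF \<beta> \<alpha> C[OF that(1)] C[OF that(2)] A[OF that(3)] q[OF that(1,3)] p[OF that(1,2)] _ that(5)]
      D that(4) by (simp add: mult.commute)
  define P where "P i j = a i * b j - a j * b i" for i j
  define Q where "Q i j = c i * e j - c j * e i" for i j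
  show ?thesis
  proof (cases "P 0 1 = 0 \<or> P 1 2 = 0 \<or> P 2 0 = 0 \<or> Q 0 1 = 0 \<or> Q 1 2 = 0 \<or> Q 2 0 = 0")
    case True
    then show ?thesis
      using par[of 0 1 2] par[of 1 2 0] par[of 2 0 1] par'[of 0 1 2] par'[of 1 2 0] par'[of 2 0 1] r
      unfolding P_def Q_def by auto
  next
    case False
    have anti: "P 2 0 = - P 0 2" "Q 2 0 = - Q 0 2" by (simp_all add: P_def Q_def)
    have ge: "\<alpha> \<le> \<bar>P i j\<bar>" if "i < 3" "j < 3" "P i j \<noteq> 0" for i j
      using p[OF that(1,2)] that(3) \<alpha> abs_le_square_iff[of \<alpha> "P i j"] by (simp add: P_def)
    have ge': "\<beta> \<le> \<bar>Q i j\<bar>" if "i < 3" "j < 3" "Q i j \<noteq> 0" for i j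
      using q[OF that(1,2)] that(3) \<beta> abs_le_square_iff[of \<beta> "Q i j"] by (simp add: Q_def)
    have "(\<alpha> * \<beta>) ^ 3 = \<alpha> * \<alpha> * \<alpha> * (\<beta> * \<beta> * \<beta>)" by (simp add: power3_eq_cube)
    also have "\<dots> \<le> \<bar>P 0 1\<bar> * \<bar>P 0 2\<bar> * \<bar>P 1 2\<bar> * (\<bar>Q 0 1\<bar> * \<bar>Q 0 2\<bar> * \<bar>Q 1 2\<bar>)"
      using False \<alpha> \<beta> anti by (intro mult_mono ge ge') auto
    also have "\<dots> \<le> 2 * \<bar>P 0 1 * P 0 2 * P 1 2 * (Q 0 1 * Q 0 2 * Q 1 2)\<bar>"
      by (simp add: abs_mult)
    also have "\<dots> \<le> ?D"
      unfolding det_tensor3_def P_def Q_def by (rule det_sym3_tensor_ge)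
    finally show ?thesis .
  qed
qed

section \<open>Semistability bounds for families of pure tensors\<close>

lemma gram_det_pair: "gram_det (\<lambda>k. if k = 0 then x else y) 2 = inner x x * inner y y - (inner x y)\<^sup>2"
  by (simp add: gram_det_2)

lemma semistable_norm_ge:
  assumes "semistable L" "x \<in> L" "x \<noteq> 0"
  shows "exp (- 2 * slope L) \<le> inner x x"
  using semistable_gram_det_ge[of L 1 "\<lambda>_. x"] assms gram_det_1[of "\<lambda>_. x"] by simp

lemma semistable_pair_ge:
  assumes "semistable L" "x \<in> L" "y \<in> L" "inner x x * inner y y - (inner x y)\<^sup>2 \<noteq> 0"
  shows "(exp (- 2 * slope L))\<^sup>2 \<le> inner x x * inner y y - (inner x y)\<^sup>2"
  using semistable_gram_det_ge[of L 2 "\<lambda>k. if k = 0 then x else y"] assms gram_det_pair[of x y] by simp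

lemma gram_det_outer_semistable_ge:
  assumes L: "semistable L" and M: "semistable M"
    and uv: "\<And>i. i < r \<Longrightarrow> u i \<in> L" "\<And>i. i < r \<Longrightarrow> v i \<in> M"
    and nz: "\<And>i. i < r \<Longrightarrow> v i \<noteq> 0" and g: "gram_det u r \<noteq> 0"
  shows "(exp (- 2 * slope L) * exp (- 2 * slope M)) ^ r \<le> gram_det (\<lambda>i. outer (u i) (v i)) r"
proof -
  have "exp (- 2 * slope M) ^ r = (\<Prod>i<r. exp (- 2 * slope M))" by simp
  also have "\<dots> \<le> (\<Prod>i<r. inner (v i) (v i))"
    using semistable_norm_ge[OF M] uv nz by (intro prod_mono) auto
  finally have "exp (- 2 * slope L) ^ r * exp (- 2 * slope M) ^ r \<le> gram_det u r * (\<Prod>i<r. inner (v i) (v i))"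
    using semistable_gram_det_ge[OF L uv(1) g] by (intro mult_mono gram_det_nonneg) auto
  also have "\<dots> \<le> gram_det (\<lambda>i. outer (u i) (v i)) r" by (rule gram_det_outer_ge)
  finally show ?thesis by (simp only: power_mult_distrib)
qed

lemma gram_det_split_ge:
  assumes L: "semistable L" and M: "semistable M" and r: "r \<le> 3"
    and uv: "\<And>i. i < r \<Longrightarrow> u i \<in> L" "\<And>i. i < r \<Longrightarrow> v i \<in> M"
    and g: "gram_det (\<lambda>i. outer (u i) (v i)) r \<noteq> 0"
  shows "(exp (- 2 * slope L) * exp (- 2 * slope M)) ^ r \<le> gram_det (\<lambda>i. outer (u i) (v i)) r"
proof -
  have "outer (u i) (v i) \<noteq> 0" if "i < r" for i
    using gram_det_nonzero_component[OF g that] .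
  then have nz: "u i \<noteq> 0" "v i \<noteq> 0" if "i < r" for i
    using that outer.zero_left outer.zero_right by metis+
  consider "gram_det u r \<noteq> 0" | "gram_det v r \<noteq> 0" | "gram_det u r = 0" "gram_det v r = 0" by blast
  then show ?thesis
  proof cases
    case 1
    then show ?thesis by (intro gram_det_outer_semistable_ge L M uv nz(2))
  next
    case 2
    then show ?thesis
      using gram_det_outer_semistable_ge[OF M L uv(2,1) nz(1)] gram_det_outer_commute[of u v r]
      by (simp add: mult.commute)
  next
    case 3
    \<comment> \<open>Only rank 3 has content: rank 0 is trivial, in rank 1 the factors are nonzero,
      and in rank 2 both pairs are proportional, which makes the two tensors dependent.\<close>
    consider "r = 0" | "r = 1" | "r = 2" | "r = 3" using r by linarith
    then show ?thesis
    proof cases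
      case 1
      then show ?thesis by simp
    next
      case 2
      then show ?thesis using 3 gram_det_1[of u] nz(1)[of 0] by simp
    next
      case three: 3
      have "(inner (u 0) (u 1))\<^sup>2 = inner (u 0) (u 0) * inner (u 1) (u 1)"
        "(inner (v 0) (v 1))\<^sup>2 = inner (v 0) (v 0) * inner (v 1) (v 1)"
        using 3 unfolding three gram_det_2 by simp_all
      then have "gram_det (\<lambda>i. outer (u i) (v i)) 2 = 0"
        unfolding gram_det_2 inner_outer power_mult_distrib by simp
      then show ?thesis using g three by simp
    next
      case 4
      obtain a b :: "nat \<Rightarrow> real" where ab: "\<And>i j. i < 3 \<Longrightarrow> j < 3 \<Longrightarrow> inner (u i) (u j) = a i * a j + b i * b j"
        using planar_coordinates[of u] 3 4 by blast
      obtain c e :: "nat \<Rightarrow> real" where ce: "\<And>i j. i < 3 \<Longrightarrow> j < 3 \<Longrightarrow> inner (v i) (v j) = c i * c j + e i * e j"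
        using planar_coordinates[of v] 3 4 by blast
      have eq: "gram_det (\<lambda>i. outer (u i) (v i)) 3 = det_tensor3 a b c e 0 1 2"
        unfolding gram_det_3 inner_outer det_tensor3_def by (simp add: ab ce)
      \<comment> \<open>Lagrange's identity turns the Gram determinant of a pair into a squared
        minor, to which \<open>semistable_pair_ge\<close> applies.\<close>
      have sq: "(s * s + t * t) * (s' * s' + t' * t') - (s * s' + t * t')\<^sup>2 = (s * t' - s' * t)\<^sup>2"
        for s t s' t' :: real by (simp add: power2_eq_square algebra_simps)
      have "(exp (- 2 * slope L) * exp (- 2 * slope M)) ^ 3 \<le> det_tensor3 a b c e 0 1 2"
      proof (rule det_tensor3_ge)
        fix i j :: nat assume i: "i < 3"
        have mem: "u i \<in> L" "v i \<in> M" "u i \<noteq> 0" "v i \<noteq> 0" using uv[of i] nz[of i] i 4 by auto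
        show "exp (- 2 * slope L) \<le> a i * a i + b i * b i"
          using semistable_norm_ge[OF L mem(1,3)] unfolding ab[OF i i] .
        show "exp (- 2 * slope M) \<le> c i * c i + e i * e i"
          using semistable_norm_ge[OF M mem(2,4)] unfolding ce[OF i i] .
        assume j: "j < 3"
        have mem': "u j \<in> L" "v j \<in> M" using uv[of j] j 4 by auto
        show "(exp (- 2 * slope L))\<^sup>2 \<le> (a i * b j - a j * b i)\<^sup>2" if "a i * b j - a j * b i \<noteq> 0"
          using semistable_pair_ge[OF L mem(1) mem'(1)] that
          unfolding ab[OF i i] ab[OF j j] ab[OF i j] sq zero_eq_power2 by blast
        show "(exp (- 2 * slope M))\<^sup>2 \<le> (c i * e j - c j * e i)\<^sup>2" if "c i * e j - c j * e i \<noteq> 0"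
          using semistable_pair_ge[OF M mem(2) mem'(2)] that
          unfolding ce[OF i i] ce[OF j j] ce[OF i j] sq zero_eq_power2 by blast
      qed (use g 4 eq in auto)
      then show ?thesis using 4 eq by simp
    qed
  qed
qed

subsection \<open>Sublattices spanned by successive minima\<close>

text \<open>Size-reducing \<open>b i\<close> against its predecessors gives a vector of
  \<open>S\<close> outside their span, so \<open>b i\<close> is no longer than it. The reduced
  vector has the same component \<open>gso b i\<close>, and \<open>reduced_norm_le\<close> bounds
  the rest.\<close>

lemma minimal_norm_le:
  assumes b: "lattice_basis S b k" and i: "i < k"
    and min: "\<And>z. z \<in> S - span (b ` {..<i}) \<Longrightarrow> norm (b i) \<le> norm z"
  shows "inner (b i) (b i) \<le> inner (gso b i) (gso b i) + (\<Sum>j<i. inner (gso b j) (gso b j)) / 4"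
proof -
  have S: "S = zspan b k" and d: "gso b i \<noteq> 0"
    using b gso_nonzero[of b k i] i by (auto simp: lattice_basis_iff)
  obtain c :: "nat \<Rightarrow> int" where c: "\<And>j. j < i \<Longrightarrow>
      \<bar>inner (b i - (\<Sum>l<i. of_int (c l) *\<^sub>R b l)) (gso b j)\<bar> \<le> inner (gso b j) (gso b j) / 2"
    using nearest_plane[of i "b i" b] by blast
  define w where "w = (\<Sum>l<i. of_int (c l) *\<^sub>R b l)"
  define z where "z = b i - w"
  have "w \<in> zspan b i" unfolding w_def by (rule zspan_sum)
  then have wspan: "w \<in> span (b ` {..<i})" using zspan_subset_span by blast
  have "zspan b i \<subseteq> S" unfolding S using i by (intro zspan_least add_subgroup_zspan zspan_base) auto
  then have "z \<in> S"
    unfolding z_def using \<open>w \<in> zspan b i\<close> i add_subgroup_zspan[of b k]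
    by (auto simp: S intro!: add_subgroup_diff zspan_base)
  have zd: "inner z (gso b i) = inner (gso b i) (gso b i)"
    unfolding z_def inner_diff_left inner_gso_self inner_gso_span[OF wspan] by simp
  then have "z \<notin> span (b ` {..<i})" using d inner_gso_span[of z b i] by auto
  then have "inner (b i) (b i) \<le> inner z z" using min[of z] \<open>z \<in> S\<close> by (simp add: norm_le)
  also have "inner z z = inner (gso b i) (gso b i) + inner (z - gso b i) (z - gso b i)"
    by (simp add: inner_diff_left inner_diff_right zd inner_commute[of "gso b i" z])
  also have "inner (z - gso b i) (z - gso b i) \<le> (\<Sum>j<i. inner (gso b j) (gso b j)) / 4"
  proof (rule reduced_norm_le)
    have "b i - gso b i \<in> span (b ` {..<i})" using diff_gso_in_span[of b i] by (simp only: span_gso)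
    then have "(b i - gso b i) - w \<in> span (b ` {..<i})" using wspan by (rule span_diff)
    then show "z - gso b i \<in> span (b ` {..<i})" by (simp add: z_def algebra_simps)
    show "\<bar>inner (z - gso b i) (gso b j)\<bar> \<le> inner (gso b j) (gso b j) / 2" if "j < i" for j
      using c[OF that] that by (simp add: z_def w_def inner_diff_left gso_orthogonal)
  qed
  finally show ?thesis by simp
qed

text \<open>With \<open>D\<^sub>i\<close> and \<open>N\<^sub>i\<close> the squared norms of the orthogonalised and the original vectors, one has
  \<open>N\<^sub>i \<le> D\<^sub>i + (\<Sum>j<i. D\<^sub>j) / 4\<close> and \<open>D\<^sub>i \<le> N\<^sub>i \<le> N\<^sub>i\<^sub>+\<^sub>1\<close>; the rest is arithmetic.\<close>
lemma minimal_basis_gram_det_ge: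
  fixes t :: real
  assumes t: "0 < t" and b: "lattice_basis S b k" and k: "0 < k" "k \<le> 3"
    and min: "\<And>i z. i < k \<Longrightarrow> z \<in> S - span (b ` {..<i}) \<Longrightarrow> norm (b i) \<le> norm z"
    and first: "t \<le> inner (b 0) (b 0)" and last: "2 * t \<le> inner (b (k - 1)) (b (k - 1))"
  shows "t ^ k \<le> gram_det b k"
proof -
  define N where "N i = inner (b i) (b i)" for i
  define D where "D i = inner (gso b i) (gso b i)" for i
  have g: "gram_det b k \<noteq> 0" and S: "S = zspan b k" using b by (auto simp: lattice_basis_iff)
  have le: "4 * N i \<le> 4 * D i + (\<Sum>j<i. D j)" if "i < k" for i
    using minimal_norm_le[OF b that min[OF that]] unfolding N_def D_def by (simp add: field_simps)
  have DN: "D i \<le> N i" for i unfolding D_def N_def by (rule gso_norm_le)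
  have D0: "D 0 = N 0" by (simp add: D_def N_def gso.simps[of b 0])
  have mono: "N i \<le> N j" if "i \<le> j" "j < k" for i j
  proof -
    have "b j \<notin> span (b ` {..<i})"
    proof
      assume "b j \<in> span (b ` {..<i})"
      moreover have "b ` {..<i} \<subseteq> b ` {..<j}" using that(1) by auto
      ultimately have "b j \<in> span (b ` {..<j})" using span_mono by blast
      then have "inner (gso b j) (gso b j) = 0" using inner_gso_span[of "b j" b j] inner_gso_self[of b j] by simp
      then show False using gso_nonzero[OF g that(2)] by simp
    qed
    then have "norm (b i) \<le> norm (b j)" using min[of i "b j"] that zspan_base[of j k b] S by auto
    then show ?thesis by (simp add: N_def norm_le)
  qed
  have gram: "gram_det b k = (\<Prod>i<k. D i)" by (simp add: gram_det_eq_prod_gso D_def)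
  have tN: "t \<le> N 0" "2 * t \<le> N (k - 1)" using first last by (simp_all add: N_def)
  consider "k = 1" | "k = 2" | "k = 3" using k by linarith
  then show ?thesis
  proof cases
    case 1
    then show ?thesis using tN D0 gram by simp
  next
    case 2
    \<comment> \<open>Since \<open>D 0 = N 0 \<le> N 1\<close>, one gets
      \<open>D 1 \<ge> 3/4 * N 1\<close>, and \<open>N 1 \<ge> 2 * t\<close>.\<close>
    have "3 / 2 * t \<le> D 1" using le[of 1] mono[of 0 1] tN 2 D0 by simp
    then have "t * t \<le> D 0 * D 1" using t tN D0 by (intro mult_mono) auto
    then show ?thesis unfolding gram by (simp add: 2 numeral_2_eq_2)
  next
    case 3
    have sum2: "(\<Sum>j<2. D j) = D 0 + D 1" by (simp add: numeral_2_eq_2)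
    have h: "t \<le> D 0" "3 * D 0 \<le> 4 * D 1" "2 * t \<le> N 2" "D 0 \<le> N 2" "D 1 \<le> N 2"
      "4 * N 2 \<le> 4 * D 2 + D 0 + D 1"
      using le[of 1] le[of 2] mono[of 0 1] mono[of 1 2] mono[of 0 2] tN 3 D0 DN[of 1] sum2 by simp_all
    have "t * t * t \<le> D 0 * D 1 * D 2"
    proof (cases "t \<le> D 1")
      case True
      \<comment> \<open>Both \<open>D 0\<close> and \<open>D 1\<close> are at most
        \<open>N 2\<close>, so \<open>D 2 \<ge> N 2 / 2\<close>.\<close>
      have "t \<le> D 2" using h(3-6) by linarith
      then show ?thesis using True h t by (intro mult_mono) auto
    next
      case False
      \<comment> \<open>Here \<open>D 1 < t\<close> forces \<open>D 0 < 4/3 * t\<close>, so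
        \<open>D 2\<close> exceeds \<open>2 * t - 7/12 * t\<close>. The product of 3/4 and 17/12 is
        51/48, which is above 1.\<close>
      have "3 / 4 * t \<le> D 1" using h(1,2) by linarith
      moreover have "17 / 12 * t \<le> D 2" using h(1-3,6) False by linarith
      ultimately
      have "t * (3 / 4 * t) * (17 / 12 * t) \<le> D 0 * D 1 * D 2"
        using h t by (intro mult_mono) auto
      moreover have "t * t * t \<le> t * (3 / 4 * t) * (17 / 12 * t)" using t by simp
      ultimately show ?thesis by linarith
    qed
    then show ?thesis unfolding gram by (simp add: 3 numeral_3_eq_3 numeral_2_eq_2 mult.assoc)
  qed
qed

theorem theorem1:
  fixes L :: "(real^'n) set" and M :: "(real^'m) set" and S :: "(real^'m^'n) set"
  assumes "semistable L" and "semistable M"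
    and "add_subgroup S" and "S \<subseteq> tensor_lat L M" and "S \<noteq> {0}"
    and "lat_rank S \<le> 3"
  shows "slope S \<le> slope (tensor_lat L M)"
proof -
  note L = assms(1) and M = assms(2)
  have lat: "is_lattice L" "is_lattice M" using L M by (auto simp: semistable_def)
  define t where "t = exp (- 2 * slope L) * exp (- 2 * slope M)"
  have t: "0 < t" by (simp add: t_def)
  have norm: "t \<le> inner x x" if "x \<in> S" "x \<noteq> 0" for x
    using tensor_lat_norm_ge(1)[OF L M, of x] that assms(4) by (auto simp: t_def)
  have split: "\<exists>u\<in>L. \<exists>v\<in>M. x = outer u v" if "x \<in> S" "x \<noteq> 0" "inner x x < 2 * t" for x
    using tensor_lat_norm_ge(2)[OF L M, of x] that assms(4) by (auto simp: t_def)
  \<comment> \<open>The lower bound on norms also shows that \<open>S\<close> is discrete.\<close>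
  have "sqrt t \<le> norm x" if "x \<in> S" "x \<noteq> 0" for x
    using norm[OF that] by (simp add: norm_eq_sqrt_inner)
  then have S: "is_lattice S"
    unfolding is_lattice_def using assms(3) t by (auto intro!: exI[of _ "sqrt t"])
  define k where "k = dim S"
  have k3: "k \<le> 3" using assms(6) by (simp add: k_def lat_rank_def)
  have "0 \<in> S" using assms(3) by (simp add: add_subgroup_def)
  then obtain x where x: "x \<in> S" "x \<noteq> 0" using assms(5) by blast
  then have "\<not> S \<subseteq> {0}" by blast
  then have k0: "0 < k" unfolding k_def by (metis dim_eq_0 gr0I)
  obtain b where b: "lattice_basis S b k"
    and min: "\<And>i z. i < k \<Longrightarrow> z \<in> S - span (b ` {..<i}) \<Longrightarrow> norm (b i) \<le> norm z"
    using minimal_basis_exists[OF S] k3 unfolding k_def by blast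
  have g: "gram_det b k \<noteq> 0" and bS: "b i \<in> S" if "i < k" for i
    using b zspan_base[OF that, of b] by (auto simp: lattice_basis_iff)
  have b0: "b i \<noteq> 0" if "i < k" for i
    using gram_det_nonzero_component[OF g[OF that] that] .
  have ge: "t ^ k \<le> gram_det b k"
  proof (cases "\<exists>i<k. 2 * t \<le> inner (b i) (b i)")
    case True
    then obtain i where i: "i < k" "2 * t \<le> inner (b i) (b i)" by blast
    \<comment> \<open>One long basis vector makes the last one long: \<open>b (k - 1)\<close> was
      itself a candidate when \<open>b i\<close> was chosen as the shortest.\<close>
    have "b (k - 1) \<in> S - span (b ` {..<i})"
    proof -
      have "gso b (k - 1) \<noteq> 0" using gso_nonzero[OF g[OF i(1)], of "k - 1"] k0 by simp
      then have "b (k - 1) \<notin> span (b ` {..<k - 1})"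
        using inner_gso_span[of "b (k - 1)" b "k - 1"] inner_gso_self[of b "k - 1"] by auto
      moreover have "span (b ` {..<i}) \<subseteq> span (b ` {..<k - 1})" using i by (intro span_mono) auto
      moreover have "b (k - 1) \<in> S" using bS k0 by simp
      ultimately show ?thesis by blast
    qed
    then have "inner (b i) (b i) \<le> inner (b (k - 1)) (b (k - 1))"
      using min[OF i(1)] by (simp add: norm_le)
    then show ?thesis
      using minimal_basis_gram_det_ge[OF t b k0 k3 min] norm[OF bS[OF k0] b0[OF k0]] i(2) by linarith
  next
    case False
    then have "\<forall>i. \<exists>u v. i < k \<longrightarrow> u \<in> L \<and> v \<in> M \<and> b i = outer u v"
      using split bS b0 by (metis not_le)
    then obtain u v where uv: "\<And>i. i < k \<Longrightarrow> u i \<in> L" "\<And>i. i < k \<Longrightarrow> v i \<in> M" "\<And>i. i < k \<Longrightarrow> b i = outer (u i) (v i)"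
      by metis
    have "gram_det b k = gram_det (\<lambda>i. outer (u i) (v i)) k" by (rule gram_det_cong) (rule uv(3))
    then show ?thesis using gram_det_split_ge[OF L M k3 uv(1,2)] g[OF k0] by (simp add: t_def)
  qed
  \<comment> \<open>If a factor had rank 0, the tensor lattice and hence \<open>S\<close> would be
    zero.\<close>
  have "dim L \<noteq> 0 \<and> dim M \<noteq> 0"
  proof (rule ccontr)
    assume "\<not> (dim L \<noteq> 0 \<and> dim M \<noteq> 0)"
    then have "L \<subseteq> {0} \<or> M \<subseteq> {0}" by (auto simp: dim_eq_0)
    then have "tensor_lat L M \<subseteq> {0}"
      by (intro tensor_lat_least) (auto simp: add_subgroup_def outer.zero_left outer.zero_right dest!: subsetD)
    then show False using x assms(4) by blast
  qed
  then have slope: "slope (tensor_lat L M) = slope L + slope M"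
    using slope_tensor lat by blast
  have "ln (t ^ k) \<le> ln (gram_det b k)" by (rule ln_mono[OF ge]) (use t in simp)
  moreover have "ln (t ^ k) = - (slope L + slope M) * (2 * real k)"
    using t by (simp add: ln_realpow) (simp add: t_def ln_mult algebra_simps)
  ultimately have "- ln (gram_det b k) \<le> (slope L + slope M) * (2 * real k)"
    by (simp add: algebra_simps)
  then show ?thesis
    unfolding slope slope_eq[OF b] using k0 by (subst pos_divide_le_eq) simp_all
qed

end
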